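(* Let $X$ be an infinite, symmetric, fully deterministic labelled graph with a rooted, oriented tree set $\mathcal{E}$ of finite type that is separated and such that $\partial_{\mathcal{E}}X$ and all $\partial_{\mathcal{E}}C$ ($C\in\mathcal{E}$) are connected. Let $C_1,\dots,C_r$ be the representatives of the types of $\mathcal{E}$, $C_0=X$, and let $\mathbf{V}=\bigcup_{i=0}^r\mathbf{V}_i$ and $\mathbf{P}$ be the variables and productions associated with $\mathcal{E}$ (and a fixed $y_0\in\partial_{\mathcal{E}}X$) as defined in the context. (a) Let the start symbol be $T_{x,y}\in\mathbf{V}_i$, where $i\in\{0,\dots,r\}$. Then the grammar $\mathcal{C}=(\mathbf{V},\Sigma,\mathbf{P},T_{x,y})$ is un-ambiguous and generates the language $$L_{x,y}(C_i)=\{\ell(\pi):\pi\text{ is a path in }X\text{ from }x\text{ to }y\text{ that lies within }C_i\}.$$ (b) The dependency digraph $\mathcal{D}(\mathcal{C})$ has the following properties. (1) If $x,x'\in\partial_{\mathcal{E}}C_i$ and $y\in\partial C_i$ (with $y=y_0$ when $i=0$), then there is an oriented path in $\mathcal{D}(\mathcal{C})$ from $T_{x,y}$ to $T_{x',y}$. (2) If $C_i\to C\in\mathcal{E}$, where $C$ has type $j$, and if $x\in\partial_{\mathcal{E}}C_i$, $y\in\partial C_i$ (with $y=y_0$ when $i=0$), $x'\in\partial_{\mathcal{E}}C_j$ and $y'\in\partial C_j$, then there is an oriented path in $\mathcal{D}(\mathcal{C})$ from $T_{x,y}$ to $T_{x',y'}$. (c) In particular, if $\mathcal{E}$ is also irreducible,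 then the strong components of $\mathcal{D}(\mathcal{C})$ are $\mathbf{V}_0$ and $\mathbf{V}_{\mathrm{ess}}=\mathbf{V}_1\cup\dots\cup\mathbf{V}_r$, and $\mathbf{V}_0\preccurlyeq\mathbf{V}_{\mathrm{ess}}$.
   Context: Graphs. Let $\Sigma$ be a finite alphabet. A directed graph labelled by $\Sigma$ has vertex set $X$ and a set $E\subset X\times\Sigma\times X$ of oriented labelled edges; loops are allowed. It is fully deterministic if for every vertex $x$ and every $a\in\Sigma$ there is precisely one edge with label $a$ starting at $x$. It is symmetric if there is a proper involution $a\mapsto a^{-1}$ of $\Sigma$ such that $(x,a,y)\in E$ implies $(y,a^{-1},x)\in E$. All graphs are strongly connected; $d$ is the graph metric. The label $\ell(\pi)\in\Sigma^*$ of a path $\pi$ is the word of labels of its successive edges (the empty path has label $\epsilon$). Tree sets. A cut is an infinite, connected, induced subgraph $C$ of $X$ such that its boundary $\partial C$ (the set of vertices of $C$ having a neighbour outside $C$) is finite and non-empty. $C^*$ denotes the complement of $C$ in $X$. Two cuts $C,D$ are non-crossing if $C\subset D$, or $D\subset C$, or $C\cap D=\emptyset$. An oriented tree set is a non-empty family $\mathcal{E}$ of pairwise non-crossing cuts with $\max\{\mathrm{diam}(\partial C): C\in\mathcal{E}\}<\infty$. It is rooted if every element of $\mathcal{E}$ is contained in a maximal element of $\mathcal{E}$ (w.r.t. inclusion). For $C,D\in\mathcal{E}$, $C\to D$ (or $C=D^-$) means that $D\subsetneq C$ and there is no $C'\in\mathcal{E}$ with $C\supsetneq C'\supsetneq D$.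 Put $\partial_{\mathcal{E}}X=\bigcap\{C^*: C\in\mathcal{E}\}$ and $\partial_{\mathcal{E}}C=C\setminus\bigcup\{D\in\mathcal{E}: D^-=C\}$. $\mathcal{E}$ tesselates $X$ if $\partial_{\mathcal{E}}X$ and all $\partial_{\mathcal{E}}C$ are finite. $\mathcal{E}$ is separated if $\partial_{\mathcal{E}}X\ne\emptyset$ and $d(\partial C,\partial D)\ge1$ for all distinct $C,D\in\mathcal{E}$. $\mathcal{E}$ has finite type if it tesselates $X$ and there are $C_1,\dots,C_r\in\mathcal{E}$ such that every $C\in\mathcal{E}$ is isomorphic with one of the $C_i$ as a labelled graph by an isomorphism $\phi_C:C\to C_i$ (chosen and fixed for each $C$) that maps $\partial_{\mathcal{E}}C$ to $\partial_{\mathcal{E}}C_i$ (it then also maps $\partial C$ to $\partial C_i$); then $C$ has type $i$. $\mathcal{E}$ is irreducible if it has finite type and for all $i,j\in\{1,\dots,r\}$, the cut $C_i$ contains as a proper subset a cut in $\mathcal{E}$ that is isomorphic with $C_j$ (in this sense, i.e. of type $j$). Put $C_0=X$, $\partial C_0=\partial_{\mathcal{E}}C_0=\partial_{\mathcal{E}}X$, and consider all maximal $C\in\mathcal{E}$ as successors of $C_0$ ($C_0\to C$). Grammars. A context-free grammar $\mathcal{C}=(\mathbf{V},\Sigma,\mathbf{P},S)$ has a finite set $\mathbf{V}$ of variables, terminal alphabet $\Sigma$, start symbol $S\in\mathbf{V}$ and a finite set $\mathbf{P}\subset\mathbf{V}\times(\mathbf{V}\cup\Sigma)^*$ of productions,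 written $T\vdash u$. A rightmost derivation step replaces $v_1Tv_2$ with $v_2\in\Sigma^*$ by $v_1uv_2$, where $T\vdash u$. The language generated is the set of $w\in\Sigma^*$ obtained from $S$ by a finite sequence of such steps; the grammar is un-ambiguous if each such $w$ has a unique rightmost derivation. The dependency digraph $\mathcal{D}(\mathcal{C})$ has vertex set $\mathbf{V}$ and an edge from $T$ to $U$ if there is a production $T\vdash u$ with $u$ containing $U$ (it does not depend on $S$). Oriented paths may have length $0$. The strong components are the classes of the equivalence relation "there are oriented paths from $T$ to $U$ and from $U$ to $T$"; for the classes $\mathbf{V}(T),\mathbf{V}(U)$ of $T,U$, $\mathbf{V}(T)\preccurlyeq\mathbf{V}(U)$ means that there is an oriented path from $T$ to $U$. The grammar associated with $\mathcal{E}$. Fix $y_0\in\partial_{\mathcal{E}}X$. The variables are symbols $T_{x,y}$ with $\mathbf{V}_0=\{T_{x,y_0}:x\in\partial_{\mathcal{E}}C_0\}$ and $\mathbf{V}_i=\{T_{x,y}:x\in\partial_{\mathcal{E}}C_i,\ y\in\partial C_i\}$ for $1\le i\le r$; $\mathbf{V}=\bigcup_{i=0}^r\mathbf{V}_i$. The productions in $\mathbf{P}$ are, for all $a,b\in\Sigma$, $i,j\in\{0,\dots,r\}$ with $j\ge1$, $x,x',x''\in\partial_{\mathcal{E}}C_i$, $y\in\partial C_i$ (with $y=y_0$ when $i=0$), and $\bar x,\bar y\in\partial C$ where $C_i\to C\in\mathcal{E}$ and $C$ has type $j$: $T_{y,y}\vdash\epsilon$; $T_{x,y}\vdash a\,T_{x',y}$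 whenever $(x,a,x')\in E$; $T_{x,y}\vdash a\,T_{\phi_C(\bar x),\phi_C(\bar y)}\,b\,T_{x'',y}$ whenever $(x,a,\bar x),(\bar y,b,x'')\in E$.
   Formalization: Two conditions are added since the claim fails without them: boundaries of disjoint cuts of the tree set are at distance at least 2 (throughout), and, in (c), each isomorphism φ_C maps every successor of C to a cut in the tree set of the same type. *)

theory Defs
  imports "Graph_Theory.Graph_Theory"
begin

section \<open>Labelled graphs\<close>

text \<open>An edge is a triple (source, label, target); walks are the arc walks of \<open>Graph_Theory\<close>.\<close>

definition lgraph :: "'v set \<Rightarrow> ('v \<times> 'a \<times> 'v) set \<Rightarrow> ('v, 'v \<times> 'a \<times> 'v) pre_digraph" where
  "lgraph X E = \<lparr>verts = X, arcs = E, tail = fst, head = (\<lambda>e. snd (snd e))\<rparr>"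

definition labelled_graph :: "'v set \<Rightarrow> 'a set \<Rightarrow> ('v \<times> 'a \<times> 'v) set \<Rightarrow> bool" where
  "labelled_graph X A E \<longleftrightarrow> finite A \<and> E \<subseteq> X \<times> A \<times> X"

definition fully_deterministic :: "'v set \<Rightarrow> 'a set \<Rightarrow> ('v \<times> 'a \<times> 'v) set \<Rightarrow> bool" where
  "fully_deterministic X A E \<longleftrightarrow> (\<forall>x\<in>X. \<forall>a\<in>A. \<exists>!y. (x, a, y) \<in> E)"

text \<open>The involution may have fixed points, so that both the fixed-point-free and the
  general reading of ``proper involution'' are covered.\<close>

definition symmetric_labelled :: "'a set \<Rightarrow> ('v \<times> 'a \<times> 'v) set \<Rightarrow> bool" where
  "symmetric_labelled A E \<longleftrightarrow>
     (\<exists>iv. (\<forall>a\<in>A. iv a \<in> A \<and> iv (iv a) = a) \<and>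
           (\<forall>x a y. (x, a, y) \<in> E \<longrightarrow> (y, iv a, x) \<in> E))"

definition connected_on :: "'v set \<Rightarrow> ('v \<times> 'a \<times> 'v) set \<Rightarrow> 'v set \<Rightarrow> bool" where
  "connected_on X E C \<longleftrightarrow> C \<subseteq> X \<and> strongly_connected (lgraph X E \<restriction> C)"

definition gdist :: "'v set \<Rightarrow> ('v \<times> 'a \<times> 'v) set \<Rightarrow> 'v \<Rightarrow> 'v \<Rightarrow> ereal" where
  "gdist X E x y = wf_digraph.\<mu> (lgraph X E) (\<lambda>_. 1) x y"

definition gset_dist :: "'v set \<Rightarrow> ('v \<times> 'a \<times> 'v) set \<Rightarrow> 'v set \<Rightarrow> 'v set \<Rightarrow> ereal" where
  "gset_dist X E B D = (INF x\<in>B. INF y\<in>D. gdist X E x y)"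

definition gdiam :: "'v set \<Rightarrow> ('v \<times> 'a \<times> 'v) set \<Rightarrow> 'v set \<Rightarrow> ereal" where
  "gdiam X E B = (SUP x\<in>B. SUP y\<in>B. gdist X E x y)"

definition walk_label :: "('v \<times> 'a \<times> 'v) list \<Rightarrow> 'a list" where
  "walk_label p = map (\<lambda>e. fst (snd e)) p"

definition path_lang ::
  "'v set \<Rightarrow> ('v \<times> 'a \<times> 'v) set \<Rightarrow> 'v set \<Rightarrow> 'v \<Rightarrow> 'v \<Rightarrow> 'a list set" where
  "path_lang X E C x y =
     {walk_label p | p. pre_digraph.awalk (lgraph X E) x p y \<and>
                        set (pre_digraph.awalk_verts (lgraph X E) x p) \<subseteq> C}"

definition labelled_iso ::
  "('v \<times> 'a \<times> 'v) set \<Rightarrow> 'v set \<Rightarrow> 'v set \<Rightarrow> ('v \<Rightarrow> 'v) \<Rightarrow> bool" where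
  "labelled_iso E C D f \<longleftrightarrow>
     bij_betw f C D \<and>
     (\<forall>x\<in>C. \<forall>y\<in>C. \<forall>a. (x, a, y) \<in> E \<longleftrightarrow> (f x, a, f y) \<in> E)"


section \<open>Tree sets\<close>

definition neighbour :: "('v \<times> 'a \<times> 'v) set \<Rightarrow> 'v \<Rightarrow> 'v \<Rightarrow> bool" where
  "neighbour E x y \<longleftrightarrow> (\<exists>a. (x, a, y) \<in> E \<or> (y, a, x) \<in> E)"

definition bdry :: "'v set \<Rightarrow> ('v \<times> 'a \<times> 'v) set \<Rightarrow> 'v set \<Rightarrow> 'v set" where
  "bdry X E C = {x \<in> C. \<exists>y \<in> X - C. neighbour E x y}"

definition cut :: "'v set \<Rightarrow> ('v \<times> 'a \<times> 'v) set \<Rightarrow> 'v set \<Rightarrow> bool" where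
  "cut X E C \<longleftrightarrow>
     infinite C \<and> connected_on X E C \<and> finite (bdry X E C) \<and> bdry X E C \<noteq> {}"

definition non_crossing :: "'v set \<Rightarrow> 'v set \<Rightarrow> bool" where
  "non_crossing C D \<longleftrightarrow> C \<subseteq> D \<or> D \<subseteq> C \<or> C \<inter> D = {}"

definition oriented_tree_set ::
  "'v set \<Rightarrow> ('v \<times> 'a \<times> 'v) set \<Rightarrow> 'v set set \<Rightarrow> bool" where
  "oriented_tree_set X E \<T> \<longleftrightarrow>
     \<T> \<noteq> {} \<and> (\<forall>C\<in>\<T>. cut X E C) \<and> (\<forall>C\<in>\<T>. \<forall>D\<in>\<T>. non_crossing C D) \<and>
     (SUP C\<in>\<T>. gdiam X E (bdry X E C)) < \<infinity>"

definition maximal_cut :: "'v set set \<Rightarrow> 'v set \<Rightarrow> bool" where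
  "maximal_cut \<T> C \<longleftrightarrow> C \<in> \<T> \<and> (\<forall>D\<in>\<T>. C \<subseteq> D \<longrightarrow> D = C)"

definition rooted :: "'v set set \<Rightarrow> bool" where
  "rooted \<T> \<longleftrightarrow> (\<forall>C\<in>\<T>. \<exists>M. maximal_cut \<T> M \<and> C \<subseteq> M)"

definition cut_succ :: "'v set set \<Rightarrow> 'v set \<Rightarrow> 'v set \<Rightarrow> bool" where
  "cut_succ \<T> C D \<longleftrightarrow>
     C \<in> \<T> \<and> D \<in> \<T> \<and> D \<subset> C \<and> \<not> (\<exists>C'\<in>\<T>. D \<subset> C' \<and> C' \<subset> C)"

definition root_part :: "'v set \<Rightarrow> 'v set set \<Rightarrow> 'v set" where
  "root_part X \<T> = (\<Inter>C\<in>\<T>. X - C)"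

definition cut_part :: "'v set set \<Rightarrow> 'v set \<Rightarrow> 'v set" where
  "cut_part \<T> C = C - \<Union> {D. cut_succ \<T> C D}"

definition tesselates :: "'v set \<Rightarrow> 'v set set \<Rightarrow> bool" where
  "tesselates X \<T> \<longleftrightarrow> finite (root_part X \<T>) \<and> (\<forall>C\<in>\<T>. finite (cut_part \<T> C))"

definition separated :: "'v set \<Rightarrow> ('v \<times> 'a \<times> 'v) set \<Rightarrow> 'v set set \<Rightarrow> bool" where
  "separated X E \<T> \<longleftrightarrow>
     root_part X \<T> \<noteq> {} \<and>
     (\<forall>C\<in>\<T>. \<forall>D\<in>\<T>. C \<noteq> D \<longrightarrow> gset_dist X E (bdry X E C) (bdry X E D) \<ge> 1)"

text \<open>
  The definition of \<open>separated\<close> permits an edge between two disjoint cuts. A path can then pass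
  directly from one successor of a cut to another one, which no production of the grammar below
  imitates, so the language and reachability claims fail. An example is the bi-infinite path on the
  integers with one more edge between \<open>1\<close> and \<open>-1\<close>, and the two families of half-lines that
  start at \<open>n \<ge> 1\<close> and \<open>-n \<le> -1\<close>. This condition excludes such edges.
\<close>

definition disjoint_cuts_apart ::
  "'v set \<Rightarrow> ('v \<times> 'a \<times> 'v) set \<Rightarrow> 'v set set \<Rightarrow> bool" where
  "disjoint_cuts_apart X E \<T> \<longleftrightarrow>
     (\<forall>C\<in>\<T>. \<forall>D\<in>\<T>. C \<inter> D = {} \<longrightarrow> gset_dist X E (bdry X E C) (bdry X E D) \<ge> 2)"

text \<open>\<open>R 1, \<dots>, R r\<close> are the representatives, \<open>tp C\<close> is the type of \<open>C\<close> and \<open>\<phi> C\<close> the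
  chosen isomorphism onto \<open>R (tp C)\<close>.\<close>

definition finite_type ::
  "'v set \<Rightarrow> ('v \<times> 'a \<times> 'v) set \<Rightarrow> 'v set set \<Rightarrow> nat \<Rightarrow> (nat \<Rightarrow> 'v set) \<Rightarrow>
   ('v set \<Rightarrow> nat) \<Rightarrow> ('v set \<Rightarrow> 'v \<Rightarrow> 'v) \<Rightarrow> bool" where
  "finite_type X E \<T> r R tp \<phi> \<longleftrightarrow>
     tesselates X \<T> \<and> (\<forall>i\<in>{1..r}. R i \<in> \<T>) \<and>
     (\<forall>C\<in>\<T>. tp C \<in> {1..r} \<and> labelled_iso E C (R (tp C)) (\<phi> C) \<and>
              \<phi> C ` cut_part \<T> C = cut_part \<T> (R (tp C)))"

definition irreducible_type ::
  "'v set \<Rightarrow> ('v \<times> 'a \<times> 'v) set \<Rightarrow> 'v set set \<Rightarrow> nat \<Rightarrow> (nat \<Rightarrow> 'v set) \<Rightarrow>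
   ('v set \<Rightarrow> nat) \<Rightarrow> ('v set \<Rightarrow> 'v \<Rightarrow> 'v) \<Rightarrow> bool" where
  "irreducible_type X E \<T> r R tp \<phi> \<longleftrightarrow>
     finite_type X E \<T> r R tp \<phi> \<and>
     (\<forall>i\<in>{1..r}. \<forall>j\<in>{1..r}. \<exists>D\<in>\<T>. D \<subset> R i \<and> tp D = j)"

text \<open>
  The isomorphisms in \<open>finite_type\<close> need not respect the types of successors. On a one-ended
  graph such as a half-line, where all cuts are isomorphic and the type of \<open>C\<close> only records the
  size of \<open>cut_part \<T> C\<close>, two cuts of equal type can have successors of different types. Then
  \<open>irreducible_type\<close> says nothing about the successors of the representatives, which are all
  that the grammar sees. This condition makes the type determine the types of the successors.
\<close>

definition types_coherent ::
  "'v set set \<Rightarrow> ('v set \<Rightarrow> nat) \<Rightarrow> ('v set \<Rightarrow> 'v \<Rightarrow> 'v) \<Rightarrow> bool" where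
  "types_coherent \<T> tp \<phi> \<longleftrightarrow>
     (\<forall>C D. cut_succ \<T> C D \<longrightarrow> \<phi> C ` D \<in> \<T> \<and> tp (\<phi> C ` D) = tp D)"

text \<open>Index \<open>0\<close> stands for \<open>C\<^sub>0 = X\<close>, index \<open>i \<ge> 1\<close> for the representative \<open>R i\<close>.
  The variables with index \<open>i\<close> are the pairs in \<open>node_part i \<times> node_exit i\<close>.\<close>

definition node :: "'v set \<Rightarrow> (nat \<Rightarrow> 'v set) \<Rightarrow> nat \<Rightarrow> 'v set" where
  "node X R i = (if i = 0 then X else R i)"

definition node_part :: "'v set \<Rightarrow> 'v set set \<Rightarrow> (nat \<Rightarrow> 'v set) \<Rightarrow> nat \<Rightarrow> 'v set" where
  "node_part X \<T> R i = (if i = 0 then root_part X \<T> else cut_part \<T> (R i))"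

definition node_exit ::
  "'v set \<Rightarrow> ('v \<times> 'a \<times> 'v) set \<Rightarrow> (nat \<Rightarrow> 'v set) \<Rightarrow> 'v \<Rightarrow> nat \<Rightarrow> 'v set" where
  "node_exit X E R y\<^sub>0 i = (if i = 0 then {y\<^sub>0} else bdry X E (R i))"

definition node_succ :: "'v set set \<Rightarrow> (nat \<Rightarrow> 'v set) \<Rightarrow> nat \<Rightarrow> 'v set \<Rightarrow> bool" where
  "node_succ \<T> R i C \<longleftrightarrow> (if i = 0 then maximal_cut \<T> C else cut_succ \<T> (R i) C)"


section \<open>Context-free grammars\<close>

datatype ('n, 't) symb = NT 'n | TM 't

record ('n, 't) grammar =
  Vars :: "'n set"
  Terms :: "'t set"
  Prods :: "('n \<times> ('n, 't) symb list) set"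
  Start :: 'n

definition context_free_grammar :: "('n, 't) grammar \<Rightarrow> bool" where
  "context_free_grammar \<G> \<longleftrightarrow>
     finite (Vars \<G>) \<and> finite (Terms \<G>) \<and> finite (Prods \<G>) \<and> Start \<G> \<in> Vars \<G> \<and>
     Prods \<G> \<subseteq> Vars \<G> \<times> lists (NT ` Vars \<G> \<union> TM ` Terms \<G>)"

definition rm_step ::
  "('n, 't) grammar \<Rightarrow> ('n, 't) symb list \<Rightarrow> ('n, 't) symb list \<Rightarrow> bool" where
  "rm_step \<G> s t \<longleftrightarrow>
     (\<exists>v1 T v2 u. v2 \<in> lists (Terms \<G>) \<and> (T, u) \<in> Prods \<G> \<and>
        s = v1 @ [NT T] @ map TM v2 \<and> t = v1 @ u @ map TM v2)"

definition rm_derivation ::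
  "('n, 't) grammar \<Rightarrow> ('n, 't) symb list list \<Rightarrow> 't list \<Rightarrow> bool" where
  "rm_derivation \<G> ds w \<longleftrightarrow>
     ds \<noteq> [] \<and> hd ds = [NT (Start \<G>)] \<and> last ds = map TM w \<and> successively (rm_step \<G>) ds"

definition gen_lang :: "('n, 't) grammar \<Rightarrow> 't list set" where
  "gen_lang \<G> = {w \<in> lists (Terms \<G>). \<exists>ds. rm_derivation \<G> ds w}"

definition unambiguous :: "('n, 't) grammar \<Rightarrow> bool" where
  "unambiguous \<G> \<longleftrightarrow> (\<forall>w \<in> gen_lang \<G>. \<exists>!ds. rm_derivation \<G> ds w)"

definition dependency :: "('n \<times> ('n, 't) symb list) set \<Rightarrow> ('n \<times> 'n) set" where
  "dependency P = {(T, U). \<exists>u. (T, u) \<in> P \<and> NT U \<in> set u}"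

definition dep_path :: "('n \<times> ('n, 't) symb list) set \<Rightarrow> 'n \<Rightarrow> 'n \<Rightarrow> bool" where
  "dep_path P T U \<longleftrightarrow> (T, U) \<in> (dependency P)\<^sup>*"

definition strong_components ::
  "'n set \<Rightarrow> ('n \<times> ('n, 't) symb list) set \<Rightarrow> 'n set set" where
  "strong_components V P =
     V // {(T, U). T \<in> V \<and> U \<in> V \<and> dep_path P T U \<and> dep_path P U T}"

definition comp_le :: "('n \<times> ('n, 't) symb list) set \<Rightarrow> 'n set \<Rightarrow> 'n set \<Rightarrow> bool" where
  "comp_le P K K' \<longleftrightarrow> (\<exists>T\<in>K. \<exists>U\<in>K'. dep_path P T U)"


section \<open>The grammar of a tree set\<close>

text \<open>The pair \<open>(x, y)\<close> is the variable \<open>T\<^bsub>x,y\<^esub>\<close>.\<close>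

definition node_vars ::
  "'v set \<Rightarrow> ('v \<times> 'a \<times> 'v) set \<Rightarrow> 'v set set \<Rightarrow> (nat \<Rightarrow> 'v set) \<Rightarrow> 'v \<Rightarrow> nat \<Rightarrow> ('v \<times> 'v) set"
  where
  "node_vars X E \<T> R y\<^sub>0 i = node_part X \<T> R i \<times> node_exit X E R y\<^sub>0 i"

definition tree_vars ::
  "'v set \<Rightarrow> ('v \<times> 'a \<times> 'v) set \<Rightarrow> 'v set set \<Rightarrow> nat \<Rightarrow> (nat \<Rightarrow> 'v set) \<Rightarrow> 'v \<Rightarrow> ('v \<times> 'v) set"
  where
  "tree_vars X E \<T> r R y\<^sub>0 = (\<Union>i\<in>{0..r}. node_vars X E \<T> R y\<^sub>0 i)"

inductive_set tree_prods ::
  "'v set \<Rightarrow> ('v \<times> 'a \<times> 'v) set \<Rightarrow> 'v set set \<Rightarrow> nat \<Rightarrow> (nat \<Rightarrow> 'v set) \<Rightarrow>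
   ('v set \<Rightarrow> 'v \<Rightarrow> 'v) \<Rightarrow> 'v \<Rightarrow> (('v \<times> 'v) \<times> ('v \<times> 'v, 'a) symb list) set"
  for X E \<T> r R \<phi> y\<^sub>0
  where
    empty: "\<lbrakk>i \<le> r; y \<in> node_exit X E R y\<^sub>0 i\<rbrakk>
      \<Longrightarrow> ((y, y), []) \<in> tree_prods X E \<T> r R \<phi> y\<^sub>0"
  | edge: "\<lbrakk>i \<le> r; x \<in> node_part X \<T> R i; x' \<in> node_part X \<T> R i; y \<in> node_exit X E R y\<^sub>0 i;
       (x, a, x') \<in> E\<rbrakk>
      \<Longrightarrow> ((x, y), [TM a, NT (x', y)]) \<in> tree_prods X E \<T> r R \<phi> y\<^sub>0"
  | excursion: "\<lbrakk>i \<le> r; x \<in> node_part X \<T> R i; x'' \<in> node_part X \<T> R i;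
       y \<in> node_exit X E R y\<^sub>0 i; node_succ \<T> R i C; xb \<in> bdry X E C; yb \<in> bdry X E C;
       (x, a, xb) \<in> E; (yb, b, x'') \<in> E\<rbrakk>
      \<Longrightarrow> ((x, y), [TM a, NT (\<phi> C xb, \<phi> C yb), TM b, NT (x'', y)])
            \<in> tree_prods X E \<T> r R \<phi> y\<^sub>0"

definition tree_grammar ::
  "'v set \<Rightarrow> 'a set \<Rightarrow> ('v \<times> 'a \<times> 'v) set \<Rightarrow> 'v set set \<Rightarrow> nat \<Rightarrow> (nat \<Rightarrow> 'v set) \<Rightarrow>
   ('v set \<Rightarrow> 'v \<Rightarrow> 'v) \<Rightarrow> 'v \<Rightarrow> 'v \<times> 'v \<Rightarrow> ('v \<times> 'v, 'a) grammar" where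
  "tree_grammar X A E \<T> r R \<phi> y\<^sub>0 S =
     \<lparr>Vars = tree_vars X E \<T> r R y\<^sub>0, Terms = A, Prods = tree_prods X E \<T> r R \<phi> y\<^sub>0, Start = S\<rparr>"

end

theory Submission
  imports Defs
begin

text \<open>
  A node is the whole graph or a cut. It is the disjoint union of its part, which is finite, and
  its successors. Boundaries of distinct cuts are disjoint and there are no edges between disjoint
  cuts. Therefore a path in a node that starts and ends in the part is a sequence of edges of the
  part and of excursions, each of which enters a successor \<open>C\<close> by an edge, runs inside \<open>C\<close> and
  returns to the part by an edge (\<open>leaving_succ_enters_part\<close>). The isomorphism \<open>\<phi> C\<close>
  preserves labels, and by full determinism it preserves boundaries (\<open>iso_bdry\<close>), so it
  identifies the words of the piece inside \<open>C\<close> with those of a variable of the representative. The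
  productions express exactly this first-step decomposition, and inductions over derivations and
  over words give the language (\<open>derives_sound\<close>, \<open>derives_complete\<close>).

  Unambiguity comes from determinism. A word together with its first vertex determines the path,
  so the first production can be read off it, including the place where an excursion leaves \<open>C\<close>
  for the first time (\<open>path_in_first_exit_unique\<close>). Hence alternative productions have disjoint
  languages (\<open>alternatives_disjoint\<close>), and the words of a right-hand side factorise uniquely
  (\<open>production_splits\<close>). For every context-free grammar these two properties force rightmost
  derivations to be unique (locale \<open>uniquely_parsing\<close>). Although variables are bare pairs of
  vertices, the nodes do not get mixed up, because an exit vertex belongs to the boundary of only
  one cut (\<open>exit_determines_node\<close>).

  In the dependency digraph, an edge of a part gives a dependency between variables with the same
  second vertex, and the parts are connected (\<open>dep_path_within_node\<close>). An excursion that enters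
  a successor along an edge and leaves along the reversed edge reaches a variable with any
  prescribed exit (\<open>dep_path_to_succ\<close>). For the strong components, irreducibility provides a cut
  of each type below each representative. Only finitely many cuts lie between the two
  (\<open>finite_cuts_between\<close>), so a chain of successors joins them, and coherence of the types
  transports each step to a representative (\<open>dep_path_to_type_of_smaller_cut\<close>). No dependency
  leads back to the root, because \<open>y\<^sub>0\<close> lies in no cut.
\<close>

section \<open>Derivations and unambiguity\<close>

text \<open>Derivability without an order of the steps: the symbols of a form are rewritten from the
  left, independently of each other. Unlike the rightmost derivations, this splits along
  concatenations of forms, so it is suited to inductions on words.\<close>

inductive derives :: "('n, 't) grammar \<Rightarrow> ('n, 't) symb list \<Rightarrow> 't list \<Rightarrow> bool"
  for G where
    Nil: "derives G [] []"
  | TM: "\<lbrakk>a \<in> Terms G; derives G s w\<rbrakk> \<Longrightarrow> derives G (TM a # s) (a # w)"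
  | NT: "\<lbrakk>(T, u) \<in> Prods G; derives G u w; derives G s w'\<rbrakk>
      \<Longrightarrow> derives G (NT T # s) (w @ w')"

inductive_cases derives_NilE: "derives G [] w"
inductive_cases derives_TME: "derives G (TM a # s) w"
inductive_cases derives_NTE: "derives G (NT T # s) w"

lemma derives_Nil_iff [simp]: "derives G [] w \<longleftrightarrow> w = []"
  by (auto elim: derives_NilE intro: derives.Nil)

lemma derives_TM_iff:
  "derives G (TM a # s) w \<longleftrightarrow> (\<exists>v. w = a # v \<and> a \<in> Terms G \<and> derives G s v)"
  by (auto elim: derives_TME intro: derives.TM)

lemma derives_NT_iff:
  "derives G (NT T # s) w \<longleftrightarrow>
     (\<exists>w1 w2. w = w1 @ w2 \<and> derives G [NT T] w1 \<and> derives G s w2)" (is "?l \<longleftrightarrow> ?r")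
proof
  assume ?l
  then obtain u w1 w2 where "w = w1 @ w2" "(T, u) \<in> Prods G" "derives G u w1" "derives G s w2"
    by (elim derives_NTE) auto
  moreover have "derives G [NT T] w1"
    using derives.NT [OF \<open>(T, u) \<in> Prods G\<close> \<open>derives G u w1\<close> derives.Nil] by simp
  ultimately show ?r by blast
next
  assume ?r
  then obtain w1 w2 where *: "w = w1 @ w2" "derives G [NT T] w1" "derives G s w2" by blast
  from *(2) obtain u where "(T, u) \<in> Prods G" "derives G u w1" by (elim derives_NTE) auto
  then show ?l using derives.NT *(1,3) by metis
qed

lemma derives_single_iff: "derives G [NT T] w \<longleftrightarrow> (\<exists>u. (T, u) \<in> Prods G \<and> derives G u w)"
  (is "?l \<longleftrightarrow> ?r")
proof
  assume ?l
  then show ?r by (elim derives_NTE) auto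
next
  assume ?r
  then obtain u where u: "(T, u) \<in> Prods G" "derives G u w" by blast
  show ?l using derives.NT [OF u derives.Nil] by simp
qed

lemma derives_append_iff:
  "derives G (s @ t) w \<longleftrightarrow> (\<exists>w1 w2. w = w1 @ w2 \<and> derives G s w1 \<and> derives G t w2)"
proof (induction s arbitrary: w)
  case Nil
  then show ?case by simp
next
  case (Cons b s)
  show ?case
  proof (cases b)
    case (NT T)
    have "derives G (b # s @ t) w \<longleftrightarrow>
        (\<exists>w1 w2. w = w1 @ w2 \<and> derives G [NT T] w1 \<and> derives G (s @ t) w2)"
      unfolding NT by (rule derives_NT_iff)
    also have "\<dots> \<longleftrightarrow> (\<exists>v1 v2 w2. w = v1 @ v2 @ w2 \<and> derives G [NT T] v1 \<and>
        derives G s v2 \<and> derives G t w2)"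
      unfolding Cons.IH by blast
    also have "\<dots> \<longleftrightarrow> (\<exists>w1 w2. w = w1 @ w2 \<and> derives G (b # s) w1 \<and> derives G t w2)"
    proof -
      have split: "derives G (b # s) w1 \<longleftrightarrow>
          (\<exists>v1 v2. w1 = v1 @ v2 \<and> derives G [NT T] v1 \<and> derives G s v2)" for w1
        unfolding NT by (rule derives_NT_iff)
      show ?thesis unfolding split by (simp only: append.assoc [symmetric]) blast
    qed
    finally show ?thesis by (simp only: append_Cons)
  next
    case (TM a)
    show ?thesis unfolding TM append_Cons derives_TM_iff Cons.IH by (safe; metis append_Cons)
  qed
qed

lemma derives_map_TM_iff: "derives G (map TM v) w \<longleftrightarrow> w = v \<and> v \<in> lists (Terms G)"
  by (induction v arbitrary: w) (auto simp: derives_TM_iff)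

lemma derives_in_lists: "derives G s w \<Longrightarrow> w \<in> lists (Terms G)"
  by (induction rule: derives.induct) auto

text \<open>\<open>derives\<close> is a least fixed point: a family of languages \<open>L\<close> that is closed under the
  productions, in the sense of \<open>form_lang\<close>, contains everything that is derivable.\<close>

fun form_lang :: "('n \<Rightarrow> 't list set) \<Rightarrow> ('n, 't) symb list \<Rightarrow> 't list set" where
  "form_lang L [] = {[]}"
| "form_lang L (TM a # s) = {a # w | w. w \<in> form_lang L s}"
| "form_lang L (NT T # s) = {w @ w' | w w'. w \<in> L T \<and> w' \<in> form_lang L s}"

lemma derives_in_form_lang:
  assumes closed: "\<And>T u w. (T, u) \<in> Prods G \<Longrightarrow> w \<in> form_lang L u \<Longrightarrow> w \<in> L T"
    and "derives G s w"
  shows "w \<in> form_lang L s"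
  using assms(2) by (induction rule: derives.induct) (auto dest: closed)

lemma rm_step_context:
  assumes "rm_step G s t" and "v2 \<in> lists (Terms G)"
  shows "rm_step G (v1 @ s @ map TM v2) (v1 @ t @ map TM v2)"
proof -
  obtain u1 T u2 u where u: "u2 \<in> lists (Terms G)" "(T, u) \<in> Prods G"
    "s = u1 @ [NT T] @ map TM u2" "t = u1 @ u @ map TM u2"
    using assms(1) unfolding rm_step_def by blast
  show ?thesis unfolding rm_step_def
    by (rule exI [of _ "v1 @ u1"], rule exI [of _ T], rule exI [of _ "u2 @ v2"], rule exI [of _ u])
      (use u assms(2) in auto)
qed

lemma rm_steps_context:
  assumes "(rm_step G)\<^sup>*\<^sup>* s t" and "v2 \<in> lists (Terms G)"
  shows "(rm_step G)\<^sup>*\<^sup>* (v1 @ s @ map TM v2) (v1 @ t @ map TM v2)"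
  using assms(1)
proof (induction rule: rtranclp_induct)
  case base
  show ?case by (rule rtranclp.rtrancl_refl)
next
  case (step t t')
  from step.IH rm_step_context [OF step.hyps(2) assms(2)] show ?case
    by (rule rtranclp.rtrancl_into_rtrancl)
qed

lemma rm_step_derives:
  assumes "rm_step G s t" and "derives G t w"
  shows "derives G s w"
proof -
  obtain v1 T v2 u where "(T, u) \<in> Prods G" "s = v1 @ [NT T] @ map TM v2" "t = v1 @ u @ map TM v2"
    using assms(1) unfolding rm_step_def by blast
  note step = this
  obtain p q z where "w = p @ q @ z" "derives G v1 p" "derives G u q" "derives G (map TM v2) z"
    using assms(2) unfolding step(3) derives_append_iff by blast
  moreover from this step(1) have "derives G [NT T] q" unfolding derives_single_iff by blast
  ultimately show ?thesis unfolding step(2) derives_append_iff by blast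
qed

text \<open>The rightmost strategy loses no words: rewriting the last factor first turns any derivation
  into rightmost steps.\<close>

lemma derives_iff_rm_steps:
  "derives G s w \<longleftrightarrow> (rm_step G)\<^sup>*\<^sup>* s (map TM w) \<and> w \<in> lists (Terms G)"
proof
  assume d: "derives G s w"
  then have "(rm_step G)\<^sup>*\<^sup>* s (map TM w)"
  proof (induction rule: derives.induct)
    case Nil
    then show ?case by simp
  next
    case (TM a s w)
    then show ?case using rm_steps_context [of G s "map TM w" "[]" "[TM a]"] by simp
  next
    case (NT T u w s w')
    note lists = derives_in_lists [OF NT.hyps(2)] derives_in_lists [OF NT.hyps(3)]
    have "(rm_step G)\<^sup>*\<^sup>* (NT T # s) (NT T # map TM w')"
      using rm_steps_context [OF NT.IH(2), of "[]" "[NT T]"] by simp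
    moreover have "rm_step G (NT T # map TM w') (u @ map TM w')"
      unfolding rm_step_def using NT.hyps(1) lists by (metis append_Cons append_Nil)
    moreover have "(rm_step G)\<^sup>*\<^sup>* (u @ map TM w') (map TM w @ map TM w')"
      using rm_steps_context [OF NT.IH(1) lists(2), of "[]"] by simp
    ultimately have "(rm_step G)\<^sup>*\<^sup>* (NT T # s) (map TM w @ map TM w')"
      by (meson rtranclp.rtrancl_into_rtrancl rtranclp_trans)
    then show ?case by simp
  qed
  with d show "(rm_step G)\<^sup>*\<^sup>* s (map TM w) \<and> w \<in> lists (Terms G)"
    by (simp add: derives_in_lists)
next
  assume "(rm_step G)\<^sup>*\<^sup>* s (map TM w) \<and> w \<in> lists (Terms G)"
  then have steps: "(rm_step G)\<^sup>*\<^sup>* s (map TM w)" and w: "w \<in> lists (Terms G)" by auto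
  from steps show "derives G s w"
  proof (induction rule: converse_rtranclp_induct)
    case base
    show ?case using w derives_map_TM_iff by blast
  next
    case (step s t)
    from step.hyps(1) step.IH show ?case by (rule rm_step_derives)
  qed
qed

lemma rtranclp_iff_successively:
  "Q\<^sup>*\<^sup>* s t \<longleftrightarrow> (\<exists>ds. ds \<noteq> [] \<and> hd ds = s \<and> last ds = t \<and> successively Q ds)" (is "?l \<longleftrightarrow> ?r")
proof
  assume ?l
  then show ?r
  proof (induction rule: converse_rtranclp_induct)
    case base
    then show ?case by (intro exI [of _ "[t]"]) simp
  next
    case (step s s')
    then obtain ds where "ds \<noteq> []" "hd ds = s'" "last ds = t" "successively Q ds" by blast
    with step.hyps(1) show ?case
      by (intro exI [of _ "s # ds"]) (auto simp: successively_Cons)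
  qed
next
  assume ?r
  then obtain ds where "ds \<noteq> []" "hd ds = s" "last ds = t" "successively Q ds" by blast
  then show ?l
  proof (induction ds arbitrary: s)
    case Nil
    then show ?case by simp
  next
    case (Cons d ds)
    then show ?case
      by (cases "ds = []") (auto simp: successively_Cons intro: converse_rtranclp_into_rtranclp)
  qed
qed

lemma gen_lang_iff_derives: "w \<in> gen_lang G \<longleftrightarrow> derives G [NT (Start G)] w"
  unfolding gen_lang_def rm_derivation_def derives_iff_rm_steps
  using rtranclp_iff_successively [of "rm_step G" "[NT (Start G)]" "map TM w"] by auto

lemma rightmost_NT_unique:
  assumes "v1 @ [NT T] @ map TM v2 = v1' @ [NT T'] @ map TM v2'"
  shows "v1 = v1' \<and> T = T' \<and> v2 = v2'"
  using assms
proof (induction v2 arbitrary: v2' rule: rev_induct)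
  case Nil
  then show ?case by (cases v2' rule: rev_cases) auto
next
  case (snoc a v2)
  then show ?case by (cases v2' rule: rev_cases) auto
qed

definition splits_uniquely ::
  "('n, 't) grammar \<Rightarrow> ('n, 't) symb list \<Rightarrow> ('n, 't) symb list \<Rightarrow> bool" where
  "splits_uniquely G s t \<longleftrightarrow> (\<forall>w1 w2 w1' w2'.
     derives G s w1 \<and> derives G t w2 \<and> derives G s w1' \<and> derives G t w2' \<and>
     w1 @ w2 = w1' @ w2' \<longrightarrow> w1 = w1' \<and> w2 = w2')"

lemma splits_uniquelyD:
  "\<lbrakk>splits_uniquely G s t; derives G s w1; derives G t w2; derives G s w1'; derives G t w2';
    w1 @ w2 = w1' @ w2'\<rbrakk> \<Longrightarrow> w1 = w1' \<and> w2 = w2'"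
  by (metis splits_uniquely_def)

text \<open>For rightmost derivations to be unique it suffices that two alternatives of a variable
  derive disjoint languages and that the words of a right-hand side split in only one way. The
  second property passes to all sentential forms, because a split inside the inserted right-hand
  side is located by the splits around the replaced variable. It shows which part of the target
  word the rightmost variable must derive, and the first property then fixes the production.\<close>

locale uniquely_parsing =
  fixes G :: "('n, 't) grammar"
  assumes alternatives_disjoint:
      "\<lbrakk>(T, u) \<in> Prods G; (T, u') \<in> Prods G; derives G u w; derives G u' w\<rbrakk> \<Longrightarrow> u = u'"
    and production_splits: "(T, u1 @ u2) \<in> Prods G \<Longrightarrow> splits_uniquely G u1 u2"
begin

definition form_splits :: "('n, 't) symb list \<Rightarrow> bool" where
  "form_splits s \<longleftrightarrow> (\<forall>s1 s2. s = s1 @ s2 \<longrightarrow> splits_uniquely G s1 s2)"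

lemma form_splitsD: "form_splits (s1 @ s2) \<Longrightarrow> splits_uniquely G s1 s2"
  unfolding form_splits_def by blast

lemma form_splits_NT: "form_splits [NT T]"
  unfolding form_splits_def splits_uniquely_def by (auto simp: Cons_eq_append_conv)

lemma form_splits_NT_middle:
  assumes "form_splits (v1 @ [NT T] @ v2)" and "(T, u) \<in> Prods G" and "(T, u') \<in> Prods G"
    and "derives G v1 p" "derives G u q" "derives G v2 z"
    and "derives G v1 p'" "derives G u' q'" "derives G v2 z'"
    and eq: "p @ q @ z = p' @ q' @ z'"
  shows "p = p' \<and> q = q' \<and> z = z'"
proof -
  have "derives G [NT T] q" "derives G [NT T] q'" using assms by (auto simp: derives_single_iff)
  then have "derives G ([NT T] @ v2) (q @ z)" "derives G ([NT T] @ v2) (q' @ z')"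
    "derives G (v1 @ [NT T]) (p @ q)" "derives G (v1 @ [NT T]) (p' @ q')"
    using assms unfolding derives_append_iff by blast+
  moreover have "splits_uniquely G v1 ([NT T] @ v2)" "splits_uniquely G (v1 @ [NT T]) v2"
    using form_splitsD [of v1 "[NT T] @ v2"] form_splitsD [of "v1 @ [NT T]" v2] assms(1) by auto
  ultimately show ?thesis
    using splits_uniquelyD [of G v1 "[NT T] @ v2" p "q @ z" p' "q' @ z'"]
      splits_uniquelyD [of G "v1 @ [NT T]" v2 "p @ q" z "p' @ q'" z'] assms by simp
qed

lemma form_splits_rm_step:
  assumes "form_splits s" and "rm_step G s t"
  shows "form_splits t"
proof -
  obtain v1 T v2' u where P: "(T, u) \<in> Prods G" and s': "s = v1 @ [NT T] @ map TM v2'"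
    and t': "t = v1 @ u @ map TM v2'"
    using assms(2) unfolding rm_step_def by blast
  define v2 :: "('n, 't) symb list" where "v2 = map TM v2'"
  have s: "s = v1 @ [NT T] @ v2" and t: "t = v1 @ u @ v2" using s' t' by (simp_all add: v2_def)
  note middle = form_splits_NT_middle [OF assms(1) [unfolded s] P P]
  have "w1 = w1' \<and> w2 = w2'"
    if st: "v1 @ u @ v2 = s1 @ s2" and d: "derives G s1 w1" "derives G s2 w2" "derives G s1 w1'"
      "derives G s2 w2'" and eq: "w1 @ w2 = w1' @ w2'" for s1 s2 w1 w2 w1' w2'
  proof -
    consider (left) x where "v1 = s1 @ x" "s2 = x @ u @ v2"
      | (mid) u1 u2 where "s1 = v1 @ u1" "u = u1 @ u2" "s2 = u2 @ v2"
      | (right) y where "s1 = v1 @ u @ y" "v2 = y @ s2"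
      using st by (fastforce simp: append_eq_append_conv2)
    then show ?thesis
    proof cases
      case left
      have "derives G (x @ [NT T] @ v2) z" if "derives G s2 z" for z
        using that P unfolding left derives_append_iff derives_single_iff by blast
      moreover have "splits_uniquely G s1 (x @ [NT T] @ v2)"
        using assms(1) form_splitsD [of s1 "x @ [NT T] @ v2"] by (simp add: s left)
      ultimately show ?thesis using d eq splits_uniquelyD by blast
    next
      case right
      have "derives G (v1 @ [NT T] @ y) z" if "derives G s1 z" for z
        using that P unfolding right derives_append_iff derives_single_iff by blast
      moreover have "splits_uniquely G (v1 @ [NT T] @ y) s2"
        using assms(1) form_splitsD [of "v1 @ [NT T] @ y" s2] by (simp add: s right)
      ultimately show ?thesis using d eq splits_uniquelyD by blast
    next
      case mid
      obtain p q1 where 1: "w1 = p @ q1" "derives G v1 p" "derives G u1 q1"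
        using d(1) unfolding mid derives_append_iff by blast
      obtain p' q1' where 2: "w1' = p' @ q1'" "derives G v1 p'" "derives G u1 q1'"
        using d(3) unfolding mid derives_append_iff by blast
      obtain q2 z where 3: "w2 = q2 @ z" "derives G u2 q2" "derives G v2 z"
        using d(2) unfolding mid derives_append_iff by blast
      obtain q2' z' where 4: "w2' = q2' @ z'" "derives G u2 q2'" "derives G v2 z'"
        using d(4) unfolding mid derives_append_iff by blast
      have "derives G u (q1 @ q2)" "derives G u (q1' @ q2')"
        using 1 2 3 4 unfolding mid derives_append_iff by blast+
      then have "p = p' \<and> q1 @ q2 = q1' @ q2' \<and> z = z'"
        using middle [of p "q1 @ q2" z p' "q1' @ q2'" z'] 1 2 3 4 eq by simp
      moreover have "splits_uniquely G u1 u2" using production_splits P mid by blast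
      ultimately show ?thesis using 1 2 3 4 splits_uniquelyD by metis
    qed
  qed
  then show ?thesis unfolding form_splits_def splits_uniquely_def t by blast
qed

lemma rm_step_unique:
  assumes "form_splits s" and st: "rm_step G s t" "derives G t w"
    and st': "rm_step G s t'" "derives G t' w"
  shows "t = t'"
proof -
  obtain v1 T v2 u where u: "(T, u) \<in> Prods G" "s = v1 @ [NT T] @ map TM v2"
    "t = v1 @ u @ map TM v2" using st(1) unfolding rm_step_def by blast
  obtain v1' T' v2' u' where u': "(T', u') \<in> Prods G" "s = v1' @ [NT T'] @ map TM v2'"
    "t' = v1' @ u' @ map TM v2'" using st'(1) unfolding rm_step_def by blast
  have same: "v1' = v1" "T' = T" "v2' = v2"
    using rightmost_NT_unique [of v1 T v2 v1' T' v2'] u u' by auto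
  obtain p q z where "w = p @ q @ z" "derives G v1 p" "derives G u q" "derives G (map TM v2) z"
    using st(2) unfolding u derives_append_iff by blast
  moreover obtain p' q' z' where "w = p' @ q' @ z'" "derives G v1 p'" "derives G u' q'"
    "derives G (map TM v2) z'"
    using st'(2) unfolding u' same derives_append_iff by blast
  ultimately have "q = q'"
    using form_splits_NT_middle [OF assms(1) [unfolded u(2)] u(1) u'(1) [unfolded same]] by blast
  then have "u = u'"
    using alternatives_disjoint u(1) u'(1) same \<open>derives G u q\<close> \<open>derives G u' q'\<close> by blast
  then show ?thesis using u u' same by simp
qed

lemma not_rm_step_map_TM: "\<not> rm_step G (map TM w) t"
proof
  assume "rm_step G (map TM w) t"
  then obtain T where "NT T \<in> set (map TM w :: ('n, 't) symb list)"
    unfolding rm_step_def by (metis in_set_conv_decomp append_Cons append_Nil)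
  then show False by auto
qed

lemma rm_derivation_list_unique:
  assumes "form_splits s" and "w \<in> lists (Terms G)"
    and "successively (rm_step G) (s # ds)" "last (s # ds) = map TM w"
    and "successively (rm_step G) (s # ds')" "last (s # ds') = map TM w"
  shows "ds = ds'"
  using assms(1,3-)
proof (induction ds arbitrary: s ds')
  case Nil
  then show ?case by (cases ds') (auto simp: not_rm_step_map_TM)
next
  case (Cons t ts)
  have step: "rm_step G s t" using Cons.prems by simp
  then obtain t' ts' where ds': "ds' = t' # ts'"
    using Cons.prems by (cases ds') (auto simp: not_rm_step_map_TM)
  have reach: "derives G v w" if "successively (rm_step G) (v # vs)" "last (v # vs) = map TM w"
    for v vs
    unfolding derives_iff_rm_steps
    using assms(2) that rtranclp_iff_successively [of "rm_step G" v "map TM w"]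
    by (metis list.sel(1) list.discI)
  have "t = t'"
    using rm_step_unique [OF Cons.prems(1) step, of w t'] reach [of t ts] reach [of t' ts']
      Cons.prems ds' by simp
  moreover have "ts = ts'"
    using Cons.IH [of t ts'] form_splits_rm_step [OF Cons.prems(1) step] Cons.prems ds'
      \<open>t = t'\<close> by simp
  ultimately show ?case by (simp add: ds')
qed

lemma unambiguous: "unambiguous G"
proof -
  have "ds = ds'" if "rm_derivation G ds w" "rm_derivation G ds' w" "w \<in> lists (Terms G)"
    for ds ds' w
    using that rm_derivation_list_unique [OF form_splits_NT that(3), of "Start G" "tl ds" "tl ds'"]
    unfolding rm_derivation_def by (metis list.collapse)
  then show ?thesis unfolding unambiguous_def gen_lang_def by blast
qed

end

section \<open>Labelled paths, boundaries and distances\<close>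

text \<open>In a deterministic graph the word and the first vertex determine a path, so paths can be
  treated by recursion on words, without arc lists.\<close>

primrec path_in :: "('v \<times> 'a \<times> 'v) set \<Rightarrow> 'v set \<Rightarrow> 'v \<Rightarrow> 'a list \<Rightarrow> 'v \<Rightarrow> bool" where
  "path_in E C x [] y \<longleftrightarrow> x = y \<and> x \<in> C"
| "path_in E C x (a # w) y \<longleftrightarrow> x \<in> C \<and> (\<exists>z. (x, a, z) \<in> E \<and> path_in E C z w y)"

lemma path_in_endpoints: "path_in E C x w y \<Longrightarrow> x \<in> C \<and> y \<in> C"
  by (induction w arbitrary: x) auto

lemma path_in_mono: "path_in E C x w y \<Longrightarrow> C \<subseteq> D \<Longrightarrow> path_in E D x w y"
  by (induction w arbitrary: x) auto

lemma path_in_appendI: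
  "path_in E C x v z \<Longrightarrow> path_in E C z w y \<Longrightarrow> path_in E C x (v @ w) y"
  by (induction v arbitrary: x) auto

lemma path_in_iso:
  assumes iso: "labelled_iso E C D f" and "x \<in> C" "y \<in> C"
  shows "path_in E D (f x) w (f y) \<longleftrightarrow> path_in E C x w y"
  using assms(2)
proof (induction w arbitrary: x)
  case Nil
  then show ?case
    using iso assms(3) unfolding labelled_iso_def bij_betw_def by (auto dest: inj_onD)
next
  case (Cons a w)
  have "(\<exists>z'. (f x, a, z') \<in> E \<and> path_in E D z' w (f y)) \<longleftrightarrow>
      (\<exists>z\<in>C. (f x, a, f z) \<in> E \<and> path_in E D (f z) w (f y))"
    using iso path_in_endpoints unfolding labelled_iso_def bij_betw_def by (metis imageE)
  also have "\<dots> \<longleftrightarrow> (\<exists>z\<in>C. (x, a, z) \<in> E \<and> path_in E C z w y)"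
    using iso Cons unfolding labelled_iso_def by metis
  also have "\<dots> \<longleftrightarrow> (\<exists>z. (x, a, z) \<in> E \<and> path_in E C z w y)"
    using path_in_endpoints by metis
  finally show ?case
    using iso Cons.prems unfolding labelled_iso_def bij_betw_def by auto
qed

lemma path_in_first_exit:
  assumes "path_in E N x w y" and "x \<in> C" and "y \<notin> C"
  shows "\<exists>p z b u q. w = p @ b # q \<and> path_in E C x p z \<and> (z, b, u) \<in> E \<and> u \<notin> C \<and>
    path_in E N u q y"
  using assms(1,2)
proof (induction w arbitrary: x)
  case Nil
  then show ?case using assms(3) by auto
next
  case (Cons a w)
  then obtain z where z: "(x, a, z) \<in> E" "path_in E N z w y" by auto
  show ?case
  proof (cases "z \<in> C")
    case True
    then obtain p z' b u q where "w = p @ b # q" "path_in E C z p z'" "(z', b, u) \<in> E" "u \<notin> C"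
      "path_in E N u q y"
      using Cons.IH [OF z(2)] by blast
    then show ?thesis using z Cons.prems(2)
      by (intro exI [of _ "a # p"] exI [of _ z'] exI [of _ b] exI [of _ u] exI [of _ q]) auto
  next
    case False
    then show ?thesis using z Cons.prems(2)
      by (intro exI [of _ "[]"] exI [of _ x] exI [of _ a] exI [of _ z] exI [of _ w]) auto
  qed
qed

text \<open>Determinism makes the path follow the same vertices in both decompositions. If \<open>p\<close> were
  shorter than \<open>p'\<close>, then the edge \<open>b\<close> that leaves \<open>C\<close> would be an edge of the
  path \<open>p'\<close>, which stays in \<open>C\<close>. Both halves of unambiguity rest on this.\<close>

lemma path_in_first_exit_unique:
  assumes det: "\<And>x a y y'. (x, a, y) \<in> E \<Longrightarrow> (x, a, y') \<in> E \<Longrightarrow> y = y'"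
    and "path_in E C x p z" "(z, b, u) \<in> E" "u \<notin> C"
    and "path_in E C x p' z'" "(z', b', u') \<in> E" "u' \<notin> C"
    and "p @ b # q = p' @ b' # q'"
  shows "p = p' \<and> z = z' \<and> b = b' \<and> u = u' \<and> q = q'"
  using assms(2-)
proof (induction p arbitrary: x p')
  case Nil
  show ?case
  proof (cases p')
    case Nil
    then show ?thesis using Nil.prems det by auto
  next
    case (Cons a p'')
    then obtain v where "(x, a, v) \<in> E" "path_in E C v p'' z'" using Nil.prems by auto
    moreover from this have "v \<in> C" using path_in_endpoints by metis
    moreover have "(x, a, u) \<in> E" using Nil.prems Cons by auto
    ultimately show ?thesis using Nil.prems det by metis
  qed
next
  case (Cons a p)
  then obtain v where v: "(x, a, v) \<in> E" "path_in E C v p z" by auto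
  show ?case
  proof (cases p')
    case Nil
    have "v \<in> C" using path_in_endpoints [OF v(2)] by blast
    moreover have "(x, a, u') \<in> E" using Cons.prems Nil by auto
    ultimately show ?thesis using Cons.prems v(1) det by metis
  next
    case p': (Cons a' p'')
    then obtain v' where v': "(x, a', v') \<in> E" "path_in E C v' p'' z'" using Cons.prems by auto
    have "v' = v" using v v' det Cons.prems p' by auto
    then show ?thesis using Cons.IH [OF v(2), of p''] Cons.prems v' p' by auto
  qed
qed

lemma wf_lgraph: "labelled_graph X A E \<Longrightarrow> wf_digraph (lgraph X E)"
  unfolding wf_digraph_def lgraph_def labelled_graph_def by auto

lemma awalk_lgraph_Nil: "pre_digraph.awalk (lgraph X E) x [] y \<longleftrightarrow> x \<in> X \<and> x = y"
  by (simp add: pre_digraph.awalk_def pre_digraph.cas.simps lgraph_def)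

lemma awalk_lgraph_Cons:
  assumes "labelled_graph X A E"
  shows "pre_digraph.awalk (lgraph X E) x ((x', a, z) # p) y \<longleftrightarrow>
    x' = x \<and> (x, a, z) \<in> E \<and> pre_digraph.awalk (lgraph X E) z p y"
  using assms unfolding labelled_graph_def
  by (auto simp: pre_digraph.awalk_def pre_digraph.cas.simps lgraph_def)

lemma path_lang_path_in:
  assumes "labelled_graph X A E" and "C \<subseteq> X"
  shows "path_lang X E C x y = {w. path_in E C x w y}"
proof -
  let ?walk = "\<lambda>x p. pre_digraph.awalk (lgraph X E) x p y \<and>
    set (pre_digraph.awalk_verts (lgraph X E) x p) \<subseteq> C"
  have verts: "pre_digraph.awalk_verts (lgraph X E) x [] = [x]"
    "pre_digraph.awalk_verts (lgraph X E) x ((x', a, z) # p) =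
      x' # pre_digraph.awalk_verts (lgraph X E) z p" for x x' a z p
    by (simp_all add: pre_digraph.awalk_verts.simps lgraph_def)
  have "?walk x p \<Longrightarrow> path_in E C x (walk_label p) y" for x p
  proof (induction p arbitrary: x)
    case Nil
    then show ?case by (auto simp: awalk_lgraph_Nil verts walk_label_def)
  next
    case (Cons e p)
    obtain x' a z where "e = (x', a, z)" by (cases e)
    then show ?case using Cons
      by (auto simp: awalk_lgraph_Cons [OF assms(1)] verts walk_label_def)
  qed
  moreover have "\<exists>p. ?walk x p \<and> walk_label p = w" if "path_in E C x w y" for x w
    using that
  proof (induction w arbitrary: x)
    case Nil
    then show ?case using assms(2)
      by (intro exI [of _ "[]"]) (auto simp: awalk_lgraph_Nil verts walk_label_def)
  next
    case (Cons a w)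
    then obtain z where "x \<in> C" "(x, a, z) \<in> E" and z: "path_in E C z w y" by auto
    moreover obtain p where "?walk z p" "walk_label p = w" using Cons.IH [OF z] by blast
    ultimately show ?case
      by (intro exI [of _ "(x, a, z) # p"])
        (auto simp: awalk_lgraph_Cons [OF assms(1)] verts walk_label_def)
  qed
  ultimately show ?thesis unfolding path_lang_def by blast
qed

lemma gset_dist_le_walk_length:
  assumes "labelled_graph X A E" and "x \<in> B" "y \<in> D"
    and "pre_digraph.awalk (lgraph X E) x p y"
  shows "gset_dist X E B D \<le> ereal (length p)"
proof -
  interpret G: wf_digraph "lgraph X E" by (rule wf_lgraph [OF assms(1)])
  have "gdist X E x y \<le> ereal (G.awalk_cost (\<lambda>_. 1) p)"
    unfolding gdist_def by (rule G.min_cost_le_walk_cost [OF assms(4)])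
  also have "G.awalk_cost (\<lambda>_. 1) p = length p"
    by (simp add: G.awalk_cost_def sum_list_triv)
  finally have "gdist X E x y \<le> ereal (length p)" .
  then show ?thesis
    unfolding gset_dist_def by (intro INF_lower2 [OF assms(2)] INF_lower2 [OF assms(3)])
qed

lemma rtrancl_if_strongly_connected:
  assumes "strongly_connected G" and "x \<in> verts G" "y \<in> verts G"
  shows "(x, y) \<in> (arcs_ends G)\<^sup>*"
proof -
  have "(x, y) \<in> rtrancl_on (verts G) (arcs_ends G)"
    using assms unfolding strongly_connected_def reachable_def by blast
  then show ?thesis
    by (induction rule: rtrancl_on.induct) (auto intro: rtrancl_into_rtrancl)
qed

lemma arcs_ends_lgraph: "arcs_ends (lgraph X E) = {(u, v). \<exists>a. (u, a, v) \<in> E}"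
  by (force simp: arcs_ends_conv lgraph_def)

lemma arcs_ends_induced:
  "arcs_ends (lgraph X E \<restriction> C) = {(u, v). u \<in> C \<and> v \<in> C \<and> (\<exists>a. (u, a, v) \<in> E)}"
  by (force simp: arcs_ends_conv lgraph_def)

text \<open>The vertices of one path from \<open>u\<close> to \<open>v\<close> form such a set: the path leaves every set that
  contains \<open>u\<close> but not \<open>v\<close>.\<close>

lemma finite_set_meeting_boundaries:
  assumes "(u, v) \<in> {(u, v). \<exists>a. (u, a, v) \<in> E}\<^sup>*" and "E \<subseteq> X \<times> A \<times> X"
  shows "\<exists>F. finite F \<and> (\<forall>S. u \<in> S \<and> v \<notin> S \<longrightarrow> bdry X E S \<inter> F \<noteq> {})"
  using assms(1)
proof (induction rule: rtrancl_induct)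
  case base
  show ?case by (rule exI [of _ "{}"]) auto
next
  case (step y z)
  then obtain F where F: "finite F" "\<And>S. u \<in> S \<Longrightarrow> y \<notin> S \<Longrightarrow> bdry X E S \<inter> F \<noteq> {}" by blast
  obtain a where a: "(y, a, z) \<in> E" using step.hyps(2) by blast
  have "bdry X E S \<inter> insert y F \<noteq> {}" if S: "u \<in> S" "z \<notin> S" for S
  proof (cases "y \<in> S")
    case True
    then have "y \<in> bdry X E S" using S a assms(2) unfolding bdry_def neighbour_def by blast
    then show ?thesis by blast
  next
    case False
    then show ?thesis using F(2) S by blast
  qed
  then show ?case using F(1) by (intro exI [of _ "insert y F"]) auto
qed


section \<open>The decomposition of the graph by the tree set\<close>

locale tree_set_grammar =
  fixes X :: "'v set" and A :: "'a set" and E :: "('v \<times> 'a \<times> 'v) set"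
    and \<T> :: "'v set set" and r :: nat and R :: "nat \<Rightarrow> 'v set"
    and tp :: "'v set \<Rightarrow> nat" and \<phi> :: "'v set \<Rightarrow> 'v \<Rightarrow> 'v" and y\<^sub>0 :: 'v
  assumes graph: "labelled_graph X A E" and strong: "strongly_connected (lgraph X E)"
    and symm: "symmetric_labelled A E" and full_det: "fully_deterministic X A E"
    and tree_set: "oriented_tree_set X E \<T>" and root: "rooted \<T>"
    and fin_type: "finite_type X E \<T> r R tp \<phi>"
    and sep: "separated X E \<T>" and apart: "disjoint_cuts_apart X E \<T>"
    and root_part_connected: "connected_on X E (root_part X \<T>)"
    and cut_part_connected: "\<forall>C\<in>\<T>. connected_on X E (cut_part \<T> C)"
    and y0: "y\<^sub>0 \<in> root_part X \<T>"
begin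

abbreviation "carrier i \<equiv> node X R i"
abbreviation "part i \<equiv> node_part X \<T> R i"
abbreviation "exits i \<equiv> node_exit X E R y\<^sub>0 i"
abbreviation "succs i C \<equiv> node_succ \<T> R i C"
abbreviation "vars i \<equiv> node_vars X E \<T> R y\<^sub>0 i"
abbreviation "prods \<equiv> tree_prods X E \<T> r R \<phi> y\<^sub>0"
abbreviation "\<G> S \<equiv> tree_grammar X A E \<T> r R \<phi> y\<^sub>0 S"

lemma edgeD: "(x, a, y) \<in> E \<Longrightarrow> x \<in> X \<and> a \<in> A \<and> y \<in> X"
  using graph unfolding labelled_graph_def by blast

lemma det: "(x, a, y) \<in> E \<Longrightarrow> (x, a, y') \<in> E \<Longrightarrow> y = y'"
  using full_det edgeD unfolding fully_deterministic_def by metis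

lemma edge_exists: "x \<in> X \<Longrightarrow> a \<in> A \<Longrightarrow> \<exists>y. (x, a, y) \<in> E"
  using full_det unfolding fully_deterministic_def by blast

lemma reverse_edge: "(x, a, y) \<in> E \<Longrightarrow> \<exists>b. (y, b, x) \<in> E"
  using symm unfolding symmetric_labelled_def by blast

lemma bdry_iff: "x \<in> bdry X E C \<longleftrightarrow> x \<in> C \<and> (\<exists>a z. (x, a, z) \<in> E \<and> z \<notin> C)"
  using edgeD reverse_edge unfolding bdry_def neighbour_def by blast

lemma bdryI: "x \<in> C \<Longrightarrow> (x, a, z) \<in> E \<Longrightarrow> z \<notin> C \<Longrightarrow> x \<in> bdry X E C"
  using bdry_iff by blast

lemma bdryI_entry: "x \<in> C \<Longrightarrow> (z, a, x) \<in> E \<Longrightarrow> z \<notin> C \<Longrightarrow> x \<in> bdry X E C"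
  by (metis bdryI reverse_edge)

lemma bdry_subset: "bdry X E C \<subseteq> C"
  unfolding bdry_def by blast

lemma tree_set_nonempty: "\<T> \<noteq> {}"
  using tree_set unfolding oriented_tree_set_def by blast

text \<open>An intersection over no cuts would be the universe, hence the appeal to
  \<open>tree_set_nonempty\<close>.\<close>

lemma root_part_iff: "x \<in> root_part X \<T> \<longleftrightarrow> x \<in> X \<and> (\<forall>C\<in>\<T>. x \<notin> C)"
  using tree_set_nonempty unfolding root_part_def by blast

lemma cutD: "C \<in> \<T> \<Longrightarrow> cut X E C"
  using tree_set unfolding oriented_tree_set_def by blast

lemma cut_subset: "C \<in> \<T> \<Longrightarrow> C \<subseteq> X"
  using cutD unfolding cut_def connected_on_def by blast

lemma cut_bdry_nonempty: "C \<in> \<T> \<Longrightarrow> bdry X E C \<noteq> {}"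
  using cutD unfolding cut_def by blast

lemma cuts_nested_or_disjoint: "C \<in> \<T> \<Longrightarrow> D \<in> \<T> \<Longrightarrow> C \<subseteq> D \<or> D \<subseteq> C \<or> C \<inter> D = {}"
  using tree_set unfolding oriented_tree_set_def non_crossing_def by blast

lemma bdrys_disjoint:
  assumes "C \<in> \<T>" "D \<in> \<T>" "C \<noteq> D"
  shows "bdry X E C \<inter> bdry X E D = {}"
proof (rule ccontr)
  assume "bdry X E C \<inter> bdry X E D \<noteq> {}"
  then obtain x where x: "x \<in> bdry X E C" "x \<in> bdry X E D" by blast
  then have "x \<in> X" using assms(1) bdry_subset cut_subset by blast
  then have "gset_dist X E (bdry X E C) (bdry X E D) \<le> 0"
    using gset_dist_le_walk_length [OF graph x, of "[]"] by (simp add: awalk_lgraph_Nil zero_ereal_def)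
  moreover have "gset_dist X E (bdry X E C) (bdry X E D) \<ge> 1"
    using sep assms unfolding separated_def by blast
  ultimately have "(1 :: ereal) \<le> 0" by (rule order_trans [rotated])
  then show False by simp
qed

lemma no_edge_between_disjoint_cuts:
  assumes "C \<in> \<T>" "D \<in> \<T>" "C \<inter> D = {}" "x \<in> C" "y \<in> D"
  shows "(x, a, y) \<notin> E"
proof
  assume e: "(x, a, y) \<in> E"
  have "gset_dist X E (bdry X E C) (bdry X E D) \<le> ereal (length [(x, a, y)])"
  proof (rule gset_dist_le_walk_length [OF graph])
    show "x \<in> bdry X E C" "y \<in> bdry X E D" using e assms bdryI bdryI_entry by blast+
    show "pre_digraph.awalk (lgraph X E) x [(x, a, y)] y"
      using e edgeD by (simp add: awalk_lgraph_Cons [OF graph] awalk_lgraph_Nil)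
  qed
  moreover have "gset_dist X E (bdry X E C) (bdry X E D) \<ge> 2"
    using apart assms unfolding disjoint_cuts_apart_def by blast
  ultimately have "(2 :: ereal) \<le> ereal (length [(x, a, y)])" by (rule order_trans [rotated])
  then show False by simp
qed

text \<open>A vertex of \<open>D\<close> with a neighbour outside of \<open>C\<close> would lie in both boundaries. Hence the
  exits of a node belong to its part, and an excursion never ends by leaving the node.\<close>

lemma bdry_disjoint_smaller_cut:
  assumes "C \<in> \<T>" "D \<in> \<T>" "D \<subset> C"
  shows "bdry X E C \<inter> D = {}"
proof (rule ccontr)
  assume "bdry X E C \<inter> D \<noteq> {}"
  then obtain x where x: "x \<in> bdry X E C" "x \<in> D" by blast
  then have "x \<in> bdry X E D" using assms(3) unfolding bdry_iff by blast
  then show False using bdrys_disjoint assms x(1) by blast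
qed

lemma representative: "i \<in> {1..r} \<Longrightarrow> R i \<in> \<T>"
  using fin_type unfolding finite_type_def by blast

lemma type_range: "C \<in> \<T> \<Longrightarrow> tp C \<in> {1..r}"
  and type_iso: "C \<in> \<T> \<Longrightarrow> labelled_iso E C (R (tp C)) (\<phi> C)"
  and type_part: "C \<in> \<T> \<Longrightarrow> \<phi> C ` cut_part \<T> C = cut_part \<T> (R (tp C))"
  using fin_type unfolding finite_type_def by blast+

lemma succsD:
  assumes "i \<le> r" "succs i C"
  shows "C \<in> \<T>" "C \<subseteq> carrier i" "C \<inter> part i = {}" "i \<noteq> 0 \<Longrightarrow> C \<subset> R i"
  using assms cut_subset
  by (auto simp: node_succ_def node_def node_part_def maximal_cut_def cut_succ_def root_part_iff
      cut_part_def split: if_splits)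

lemma succs_disjoint:
  assumes "i \<le> r" "succs i C" "succs i D" "C \<noteq> D"
  shows "C \<inter> D = {}"
  using assms cuts_nested_or_disjoint [of C D] succsD(1)
  unfolding node_succ_def maximal_cut_def cut_succ_def by (metis psubsetI)

lemma carrier_cases:
  assumes "i \<le> r" "z \<in> carrier i"
  obtains "z \<in> part i" | C where "succs i C" "z \<in> C"
proof (cases "i = 0")
  case True
  show ?thesis
  proof (cases "z \<in> part i")
    case False
    then obtain C where "C \<in> \<T>" "z \<in> C"
      using assms True by (auto simp: node_part_def node_def root_part_iff)
    then show ?thesis
      using that(2) root True unfolding rooted_def node_succ_def by (metis subsetD)
  qed (use that(1) in blast)
next
  case False
  then show ?thesis
    using assms that unfolding node_part_def node_def node_succ_def cut_part_def by auto
qed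

lemma part_subset: "part i \<subseteq> carrier i"
  by (auto simp: node_part_def node_def root_part_iff cut_part_def)

lemma carrier_subset: "i \<le> r \<Longrightarrow> carrier i \<subseteq> X"
  using cut_subset [OF representative] by (auto simp: node_def)

lemma bdry_subset_cut_part: "C \<in> \<T> \<Longrightarrow> bdry X E C \<subseteq> cut_part \<T> C"
  using bdry_disjoint_smaller_cut bdry_subset unfolding cut_part_def cut_succ_def by blast

lemma exits_subset: "i \<le> r \<Longrightarrow> exits i \<subseteq> part i"
  using y0 bdry_subset_cut_part [OF representative] by (auto simp: node_exit_def node_part_def)

text \<open>Boundaries of distinct cuts are disjoint, so the second component of a variable already
  tells which node the variable belongs to.\<close>

lemma exit_determines_node:
  assumes "i \<le> r" "j \<le> r" "y \<in> exits i" "y \<in> exits j"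
  shows "i = 0 \<and> j = 0 \<or> i \<noteq> 0 \<and> j \<noteq> 0 \<and> R i = R j"
proof -
  have "y\<^sub>0 \<notin> bdry X E (R k)" if "k \<le> r" "k \<noteq> 0" for k
    using y0 bdry_subset [of "R k"] representative [of k] that unfolding root_part_iff by auto
  moreover have "R i = R j" if "i \<noteq> 0" "j \<noteq> 0"
    using that assms bdrys_disjoint [of "R i" "R j"] representative [of i] representative [of j]
    unfolding node_exit_def by auto
  ultimately show ?thesis using assms unfolding node_exit_def by (auto split: if_splits)
qed

text \<open>A path leaves a successor only into the part of its node: the exit vertex lies in the
  boundary of the successor, which is disjoint from the boundary of the node, and edges between
  distinct successors do not exist.\<close>

lemma leaving_succ_enters_part:
  assumes i: "i \<le> r" and C: "succs i C" and "x \<in> C" "(x, a, z) \<in> E" "z \<notin> C"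
  shows "z \<in> part i"
proof -
  have "z \<in> carrier i"
  proof (rule ccontr)
    assume z: "z \<notin> carrier i"
    then have "i \<noteq> 0" using edgeD [OF assms(4)] unfolding node_def by (auto split: if_splits)
    then have "R i \<in> \<T>" "C \<subset> R i" using representative [of i] i succsD(4) [OF i C] by auto
    moreover from this have "x \<in> bdry X E (R i)"
      using bdryI [of x "R i" a z] assms(3,4) z \<open>i \<noteq> 0\<close> unfolding node_def by auto
    ultimately show False using bdry_disjoint_smaller_cut succsD(1) [OF i C] assms(3) by blast
  qed
  then show ?thesis
  proof (rule carrier_cases [OF i])
    fix D assume D: "succs i D" "z \<in> D"
    then have "C \<inter> D = {}" using succs_disjoint [OF i C D(1)] assms(5) by blast
    then show ?thesis
      using no_edge_between_disjoint_cuts [OF succsD(1) [OF i C] succsD(1) [OF i D(1)]] assms D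
      by blast
  qed
qed

text \<open>By full determinism, a vertex of a cut is in the boundary iff some label has no edge at this
  vertex that stays inside the cut, which a labelled isomorphism preserves.\<close>

lemma iso_bdry:
  assumes "labelled_iso E C D f" and "C \<subseteq> X" "D \<subseteq> X"
  shows "f ` bdry X E C = bdry X E D"
proof -
  have bij: "inj_on f C" "f ` C = D" and
    hom: "\<And>x y a. x \<in> C \<Longrightarrow> y \<in> C \<Longrightarrow> (x, a, y) \<in> E \<longleftrightarrow> (f x, a, f y) \<in> E"
    using assms(1) unfolding labelled_iso_def bij_betw_def by auto
  have "f x \<in> bdry X E D \<longleftrightarrow> x \<in> bdry X E C" if x: "x \<in> C" for x
  proof
    assume "x \<in> bdry X E C"
    then obtain a z where z: "(x, a, z) \<in> E" "z \<notin> C" unfolding bdry_iff by blast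
    obtain w where w: "(f x, a, w) \<in> E"
      using edge_exists [of "f x" a] edgeD [OF z(1)] bij x assms(3) by blast
    have "w \<notin> D"
    proof
      assume "w \<in> D"
      then obtain v where "w = f v" "v \<in> C" using bij by blast
      then have "(x, a, v) \<in> E" using hom [OF x, of v a] w by blast
      then have "v = z" by (rule det [OF _ z(1)])
      then show False using z(2) \<open>v \<in> C\<close> by blast
    qed
    then show "f x \<in> bdry X E D" using bdryI w x bij by blast
  next
    assume "f x \<in> bdry X E D"
    then obtain a w where w: "(f x, a, w) \<in> E" "w \<notin> D" unfolding bdry_iff by blast
    obtain z where z: "(x, a, z) \<in> E" using edge_exists [of x a] edgeD [OF w(1)] x assms(2) by blast
    have "z \<notin> C"
    proof
      assume "z \<in> C"
      then have "f z \<in> D" "(x, a, z) \<in> E \<longleftrightarrow> (f x, a, f z) \<in> E" using hom [OF x] bij by auto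
      then show False using det [OF w(1), of "f z"] z w(2) by blast
    qed
    then show "x \<in> bdry X E C" using bdryI z x by blast
  qed
  then show ?thesis using bij bdry_subset by blast
qed

lemma type_bdry: "C \<in> \<T> \<Longrightarrow> \<phi> C ` bdry X E C = bdry X E (R (tp C))"
  using iso_bdry [OF type_iso] cut_subset representative type_range by blast

lemma excursion_var:
  assumes "C \<in> \<T>" "xb \<in> bdry X E C" "yb \<in> bdry X E C"
  shows "tp C \<le> r" "tp C \<noteq> 0" "(\<phi> C xb, \<phi> C yb) \<in> vars (tp C)"
proof -
  show *: "tp C \<le> r" "tp C \<noteq> 0" using type_range [OF assms(1)] by auto
  have "\<phi> C xb \<in> cut_part \<T> (R (tp C))" "\<phi> C yb \<in> bdry X E (R (tp C))"
    using assms bdry_subset_cut_part type_part type_bdry by blast+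
  then show "(\<phi> C xb, \<phi> C yb) \<in> vars (tp C)"
    using *(2) unfolding node_vars_def node_part_def node_exit_def by simp
qed

lemma excursion_path_iff:
  assumes "C \<in> \<T>" "xb \<in> bdry X E C" "yb \<in> bdry X E C"
  shows "path_in E (carrier (tp C)) (\<phi> C xb) w (\<phi> C yb) \<longleftrightarrow> path_in E C xb w yb"
proof -
  have "xb \<in> C" "yb \<in> C" using assms bdry_subset by blast+
  then show ?thesis
    using path_in_iso [OF type_iso [OF assms(1)]] excursion_var(2) [OF assms]
    unfolding node_def by simp
qed


section \<open>The language of the grammar\<close>

lemma grammar_simps [simp]:
  "Prods (\<G> S) = prods" "Terms (\<G> S) = A" "Start (\<G> S) = S"
  "Vars (\<G> S) = tree_vars X E \<T> r R y\<^sub>0"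
  by (simp_all add: tree_grammar_def)

lemma production_exit: "((x, y), u) \<in> prods \<Longrightarrow> \<exists>i\<le>r. y \<in> exits i"
  by (erule tree_prods.cases) auto

text \<open>A production mentions its node only through an index. By the disjointness of boundaries the
  index can be taken to be any index whose exits contain the second component.\<close>

lemma production_cases:
  assumes "((x, y), u) \<in> prods" and i: "i \<le> r" "y \<in> exits i"
  obtains (empty) "x = y" "u = []"
  | (edge) a x' where "x \<in> part i" "x' \<in> part i" "(x, a, x') \<in> E" "u = [TM a, NT (x', y)]"
  | (excursion) a C xb yb b x'' where "x \<in> part i" "x'' \<in> part i" "succs i C"
      "xb \<in> bdry X E C" "yb \<in> bdry X E C" "(x, a, xb) \<in> E" "(yb, b, x'') \<in> E"
      "u = [TM a, NT (\<phi> C xb, \<phi> C yb), TM b, NT (x'', y)]"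
proof -
  have same: "part j = part i" "node_succ \<T> R j = node_succ \<T> R i" if "j \<le> r" "y \<in> exits j" for j
    using exit_determines_node [OF that(1) i(1) that(2) i(2)]
    by (auto simp: node_part_def node_succ_def)
  show thesis
    using assms(1)
  proof (cases rule: tree_prods.cases)
    case (empty j)
    then show ?thesis using that(1) by simp
  next
    case (edge j x' a)
    then show ?thesis using that(2) same by simp
  next
    case (excursion j x'' C xb yb a b)
    then show ?thesis using that(3) same by simp
  qed
qed

text \<open>The path languages are closed under the productions: an excursion production inserts a path
  of the representative, which \<open>\<phi> C\<close> pulls back to a path of the same word in \<open>C\<close>.\<close>

lemma derives_sound:
  assumes "derives (\<G> S) [NT (x, y)] w" and "i \<le> r" "(x, y) \<in> vars i"
  shows "path_in E (carrier i) x w y"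
proof -
  define L where "L = (\<lambda>v. {w. \<forall>i\<le>r. v \<in> vars i \<longrightarrow> path_in E (carrier i) (fst v) w (snd v)})"
  have closed: "w \<in> L v" if v: "(v, u) \<in> Prods (\<G> S)" and w: "w \<in> form_lang L u" for v u w
    unfolding L_def
  proof (intro CollectI allI impI)
    fix i assume i: "i \<le> r" "v \<in> vars i"
    obtain x y where xy: "v = (x, y)" "x \<in> part i" "y \<in> exits i"
      using i(2) unfolding node_vars_def by blast
    have var: "(x', y) \<in> vars i" if "x' \<in> part i" for x'
      using that xy unfolding node_vars_def by blast
    have x: "x \<in> carrier i" using xy part_subset by blast
    have P: "((x, y), u) \<in> prods" using v xy by simp
    show "path_in E (carrier i) (fst v) w (snd v)"
      using P i(1) xy(3)
    proof (cases rule: production_cases)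
      case empty
      then show ?thesis using w x xy by simp
    next
      case (edge a x')
      then obtain w' where "w = a # w'" "w' \<in> L (x', y)" using w by auto
      then show ?thesis using edge x xy i var unfolding L_def by auto
    next
      case (excursion a C xb yb b x'')
      then obtain p q where pq: "w = a # p @ b # q" "p \<in> L (\<phi> C xb, \<phi> C yb)" "q \<in> L (x'', y)"
        using w by auto
      have C: "C \<in> \<T>" "C \<subseteq> carrier i" using succsD [OF i(1) excursion(3)] by auto
      have "path_in E (carrier (tp C)) (\<phi> C xb) p (\<phi> C yb)"
        using pq(2) excursion_var [OF C(1) excursion(4,5)] unfolding L_def by auto
      then have "path_in E C xb p yb" using excursion_path_iff [OF C(1) excursion(4,5)] by blast
      then have p: "path_in E (carrier i) xb p yb" using C(2) by (rule path_in_mono)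
      moreover have "path_in E (carrier i) x'' q y"
        using pq(3) i var excursion(2) unfolding L_def by auto
      ultimately have "path_in E (carrier i) xb (p @ b # q) y"
        using excursion(7) path_in_endpoints [OF p] by (intro path_in_appendI [OF p]) auto
      then show ?thesis using pq(1) xy x excursion(6) by auto
    qed
  qed
  then have "w \<in> form_lang L [NT (x, y)]"
    using derives_in_form_lang [of "\<G> S" L] assms(1) by blast
  then show ?thesis using assms(2,3) unfolding L_def by auto
qed

text \<open>Conversely, the first step of a path in a node either stays in the part or enters a successor
  \<open>C\<close>. In the second case the path leaves \<open>C\<close> again, since its last vertex is an exit of the
  node; the piece inside \<open>C\<close> and the rest after the return are both shorter.\<close>

lemma derives_complete:
  assumes "path_in E (carrier i) x w y" and "i \<le> r" "(x, y) \<in> vars i"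
  shows "derives (\<G> S) [NT (x, y)] w"
  using assms
proof (induction w arbitrary: i x y rule: length_induct)
  case (1 w)
  have IH: "derives (\<G> S) [NT (x', y')] v"
    if "length v < length w" "path_in E (carrier j) x' v y'" "j \<le> r" "(x', y') \<in> vars j" for v j x' y'
    using 1(1) that by blast
  note path = 1(2) and i = 1(3)
  have xy: "x \<in> part i" "y \<in> exits i" using 1(4) unfolding node_vars_def by auto
  show ?case
  proof (cases w)
    case Nil
    then have "((x, y), []) \<in> prods" using path i xy tree_prods.empty by fastforce
    then show ?thesis unfolding derives_single_iff Nil using derives.Nil by auto
  next
    case (Cons a w')
    then obtain z where z: "(x, a, z) \<in> E" "path_in E (carrier i) z w' y" using path by auto
    then have "z \<in> carrier i" using path_in_endpoints [OF z(2)] by blast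
    then show ?thesis
    proof (rule carrier_cases [OF i])
      assume zi: "z \<in> part i"
      then have "derives (\<G> S) [NT (z, y)] w'"
        using Cons z(2) i xy zi by (intro IH [of _ i]) (auto simp: node_vars_def)
      then have "derives (\<G> S) [TM a, NT (z, y)] w"
        unfolding Cons derives_TM_iff using edgeD [OF z(1)] by auto
      moreover have "((x, y), [TM a, NT (z, y)]) \<in> prods"
        using i xy zi z(1) by (intro tree_prods.edge) auto
      ultimately show ?thesis unfolding derives_single_iff by auto
    next
      fix C assume C: "succs i C" "z \<in> C"
      have CT: "C \<in> \<T>" using succsD [OF i C(1)] by auto
      have disj: "C \<inter> part i = {}" using succsD [OF i C(1)] by auto
      have "y \<notin> C" using disj exits_subset [OF i] xy by blast
      then obtain p yb b x'' q where w': "w' = p @ b # q" and p: "path_in E C z p yb"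
        and out: "(yb, b, x'') \<in> E" "x'' \<notin> C" and q: "path_in E (carrier i) x'' q y"
        using path_in_first_exit [OF z(2) C(2)] by blast
      have x'': "x'' \<in> part i"
        using leaving_succ_enters_part [OF i C(1) _ out] path_in_endpoints [OF p] by blast
      have zb: "z \<in> bdry X E C" using bdryI_entry [OF C(2) z(1)] disj xy by blast
      have yb: "yb \<in> bdry X E C" using bdryI [OF _ out] path_in_endpoints [OF p] by blast
      have "derives (\<G> S) [NT (\<phi> C z, \<phi> C yb)] p"
        using excursion_path_iff [OF CT zb yb] p excursion_var [OF CT zb yb] Cons w'
        by (intro IH [of _ "tp C"]) auto
      moreover have "derives (\<G> S) [NT (x'', y)] q"
        using q i xy x'' Cons w' by (intro IH [of _ i]) (auto simp: node_vars_def)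
      ultimately have "derives (\<G> S) [TM a, NT (\<phi> C z, \<phi> C yb), TM b, NT (x'', y)] w"
        unfolding Cons w' derives_TM_iff derives_NT_iff [where s = "[TM b, NT (x'', y)]"]
        using edgeD [OF z(1)] edgeD [OF out(1)] by auto
      moreover have "((x, y), [TM a, NT (\<phi> C z, \<phi> C yb), TM b, NT (x'', y)]) \<in> prods"
        using i xy x'' C zb yb z(1) out(1) by (intro tree_prods.excursion) auto
      ultimately show ?thesis unfolding derives_single_iff by auto
    qed
  qed
qed

lemma gen_lang_grammar:
  assumes "i \<le> r" "(x, y) \<in> vars i"
  shows "gen_lang (\<G> (x, y)) = path_lang X E (carrier i) x y"
  using gen_lang_iff_derives [of _ "\<G> (x, y)"] derives_sound [OF _ assms]
    derives_complete [OF _ assms] path_lang_path_in [OF graph carrier_subset [OF assms(1)]]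
  by auto


section \<open>Unambiguity\<close>

lemma first_exit_unique:
  assumes "path_in E C x p z" "(z, b, u) \<in> E" "u \<notin> C"
    and "path_in E C x p' z'" "(z', b', u') \<in> E" "u' \<notin> C"
    and "p @ b # q = p' @ b' # q'"
  shows "p = p' \<and> z = z' \<and> b = b' \<and> u = u' \<and> q = q'"
  by (rule path_in_first_exit_unique [OF _ assms]) (rule det)

lemma derives_excursion:
  assumes "C \<in> \<T>" "xb \<in> bdry X E C" "yb \<in> bdry X E C"
    and "derives (\<G> S) [TM a, NT (\<phi> C xb, \<phi> C yb), TM b, NT v] w"
  obtains p q where "w = a # p @ b # q" "path_in E C xb p yb" "derives (\<G> S) [NT v] q"
proof -
  obtain w1 where w1: "w = a # w1" "derives (\<G> S) (NT (\<phi> C xb, \<phi> C yb) # [TM b, NT v]) w1"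
    using assms(4) unfolding derives_TM_iff by auto
  then obtain p w2 where w2: "w1 = p @ w2" "derives (\<G> S) [NT (\<phi> C xb, \<phi> C yb)] p"
      "derives (\<G> S) [TM b, NT v] w2"
    unfolding derives_NT_iff [where s = "[TM b, NT v]"] by auto
  moreover obtain q where "w2 = b # q" "derives (\<G> S) [NT v] q"
    using w2(3) unfolding derives_TM_iff by auto
  moreover have "path_in E C xb p yb"
    using derives_sound [OF w2(2)] excursion_var [OF assms(1-3)] excursion_path_iff [OF assms(1-3)]
    by blast
  ultimately show thesis using that w1 by simp
qed

text \<open>The first letter and \<open>x\<close> determine the first edge, which decides whether the production is an
  excursion and, as successors are disjoint, into which of them. The first exit from it then
  determines \<open>yb\<close>, \<open>b\<close> and \<open>x''\<close>.\<close>

lemma alternatives_disjoint: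
  assumes v: "(v, u) \<in> prods" "(v, u') \<in> prods"
    and w: "derives (\<G> S) u w" "derives (\<G> S) u' w"
  shows "u = u'"
proof -
  obtain x y where "v = (x, y)" by (cases v)
  then have P: "((x, y), u) \<in> prods" "((x, y), u') \<in> prods" using v by auto
  obtain i where i: "i \<le> r" "y \<in> exits i" using production_exit P by blast
  have no_mix: False
    if "x' \<in> part i" "(x, a, x') \<in> E" "succs i C" "xb \<in> bdry X E C" "(x, a, xb) \<in> E" for x' a C xb
    using det [OF that(2,5)] that bdry_subset succsD(3) [OF i(1) that(3)] by blast
  show ?thesis
    using P(1) i
  proof (cases rule: production_cases)
    case empty
    show ?thesis using P(2) i
      by (cases rule: production_cases) (use empty w in \<open>auto simp: derives_TM_iff\<close>)
  next
    case (edge a x')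
    show ?thesis using P(2) i
    proof (cases rule: production_cases)
      case empty
      then show ?thesis using edge w by (auto simp: derives_TM_iff)
    next
      case e2: (edge a' x2)
      then have "a' = a" using edge w by (auto simp: derives_TM_iff)
      then show ?thesis using edge e2 det [OF edge(3), of x2] by simp
    next
      case (excursion a' C xb yb b x'')
      then have "a' = a" using edge w by (auto simp: derives_TM_iff)
      then show ?thesis using no_mix edge excursion by blast
    qed
  next
    case (excursion a C xb yb b x'')
    show ?thesis using P(2) i
    proof (cases rule: production_cases)
      case empty
      then show ?thesis using excursion w by (auto simp: derives_TM_iff)
    next
      case (edge a' x')
      then have "a' = a" using excursion w by (auto simp: derives_TM_iff)
      then show ?thesis using no_mix edge excursion by blast
    next
      case e2: (excursion a' C' xb' yb' b' x2)
      have C: "C \<in> \<T>" "C' \<in> \<T>" using succsD [OF i(1)] excursion e2 by auto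
      obtain p q where w1: "w = a # p @ b # q" "path_in E C xb p yb"
        using derives_excursion [OF C(1) excursion(4,5)] w(1) excursion(8) by blast
      obtain p' q' where w2: "w = a' # p' @ b' # q'" "path_in E C' xb' p' yb'"
        using derives_excursion [OF C(2) e2(4,5)] w(2) e2(8) by blast
      have a: "a' = a" using w1 w2 by simp
      then have xb: "xb' = xb" using det [OF excursion(6), of xb'] e2(6) by simp
      then have same: "C' = C"
        using succs_disjoint [OF i(1) excursion(3) e2(3)] excursion(4) e2(4) bdry_subset by blast
      have "x'' \<notin> C" "x2 \<notin> C"
        using succsD(3) [OF i(1) excursion(3)] excursion(2) e2(2) by auto
      then have "yb = yb' \<and> b = b' \<and> x'' = x2"
        using first_exit_unique [OF w1(2) excursion(7), of p' yb' b' x2 q q'] w1(1) w2 e2(7) xb same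
        by auto
      then show ?thesis using excursion(8) e2(8) a xb same by simp
    qed
  qed
qed

lemma splits_uniquely_Nil: "splits_uniquely G [] t" "splits_uniquely G s []"
  by (auto simp: splits_uniquely_def)

lemma splits_uniquely_TM: "splits_uniquely G [TM a] t"
  by (auto simp: splits_uniquely_def derives_TM_iff)

text \<open>In the word of an excursion, the first factor ends where the path leaves the successor for
  the first time. The terminal \<open>b\<close> after it is needed to see this.\<close>

lemma production_splits:
  assumes P: "(v, u1 @ u2) \<in> prods"
  shows "splits_uniquely (\<G> S) u1 u2"
proof -
  obtain x y where v: "v = (x, y)" by (cases v)
  obtain i where i: "i \<le> r" "y \<in> exits i" using production_exit P v by blast
  from P have "((x, y), u1 @ u2) \<in> prods" using v by simp
  then show ?thesis using i
  proof (cases rule: production_cases)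
    case empty
    then show ?thesis by (simp add: splits_uniquely_Nil)
  next
    case (edge a x')
    then show ?thesis
      by (auto simp: append_eq_Cons_conv Cons_eq_append_conv
          intro: splits_uniquely_Nil splits_uniquely_TM)
  next
    case (excursion a C xb yb b x'')
    have C: "C \<in> \<T>" using succsD [OF i(1)] excursion by auto
    have out: "x'' \<notin> C" using succsD(3) [OF i(1) excursion(3)] excursion(2) by auto
    let ?s = "NT (\<phi> C xb, \<phi> C yb)" and ?t = "NT (x'', y)"
    have parts: "(\<exists>p. w = a # p \<and> path_in E C xb p yb)" if "derives (\<G> S) [TM a, ?s] w" for w
      using that derives_sound excursion_var [OF C excursion(4,5)]
        excursion_path_iff [OF C excursion(4,5)] unfolding derives_TM_iff by blast
    have "splits_uniquely (\<G> S) [TM a, ?s] [TM b, ?t]"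
      unfolding splits_uniquely_def
    proof (intro allI impI, elim conjE)
      fix w1 w2 w1' w2'
      assume d: "derives (\<G> S) [TM a, ?s] w1" "derives (\<G> S) [TM b, ?t] w2"
        "derives (\<G> S) [TM a, ?s] w1'" "derives (\<G> S) [TM b, ?t] w2'"
        and eq: "w1 @ w2 = w1' @ w2'"
      obtain p p' where p: "w1 = a # p" "path_in E C xb p yb" "w1' = a # p'" "path_in E C xb p' yb"
        using parts [OF d(1)] parts [OF d(3)] by blast
      obtain q q' where q: "w2 = b # q" "w2' = b # q'"
        using d(2,4) unfolding derives_TM_iff by blast
      show "w1 = w1' \<and> w2 = w2'"
        using first_exit_unique [OF p(2) excursion(7) out p(4) excursion(7) out, of q q']
          p q eq by auto
    qed
    moreover have "splits_uniquely (\<G> S) [TM a, ?s, TM b] [?t]"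
      unfolding splits_uniquely_def
    proof (intro allI impI, elim conjE)
      fix w1 w2 w1' w2'
      assume d: "derives (\<G> S) [TM a, ?s, TM b] w1" "derives (\<G> S) [?t] w2"
        "derives (\<G> S) [TM a, ?s, TM b] w1'" "derives (\<G> S) [?t] w2'"
        and eq: "w1 @ w2 = w1' @ w2'"
      have "\<exists>p. w = a # p @ [b] \<and> path_in E C xb p yb" if "derives (\<G> S) [TM a, ?s, TM b] w" for w
      proof -
        have "derives (\<G> S) ([TM a, ?s] @ [TM b]) w" using that by simp
        then obtain w1 where "w = w1 @ [b]" "derives (\<G> S) [TM a, ?s] w1"
          unfolding derives_append_iff by (auto simp: derives_TM_iff [where s = "[]"])
        then show ?thesis using parts by auto
      qed
      from this [OF d(1)] this [OF d(3)] obtain p p' where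
        p: "w1 = a # p @ [b]" "path_in E C xb p yb" "w1' = a # p' @ [b]" "path_in E C xb p' yb"
        by blast
      show "w1 = w1' \<and> w2 = w2'"
        using first_exit_unique [OF p(2) excursion(7) out p(4) excursion(7) out, of w2 w2'] p eq
        by auto
    qed
    ultimately show ?thesis using excursion(8)
      by (auto simp: append_eq_Cons_conv Cons_eq_append_conv
          intro: splits_uniquely_Nil splits_uniquely_TM)
  qed
qed

lemma unambiguous_grammar: "unambiguous (\<G> S)"
proof -
  interpret uniquely_parsing "\<G> S"
  proof
    show "u = u'" if "(v, u) \<in> Prods (\<G> S)" "(v, u') \<in> Prods (\<G> S)" "derives (\<G> S) u w"
      "derives (\<G> S) u' w" for v u u' w
      using alternatives_disjoint [of v u u' S w] that by simp
    show "splits_uniquely (\<G> S) u1 u2" if "(v, u1 @ u2) \<in> Prods (\<G> S)" for v u1 u2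
      using production_splits that by simp
  qed
  show ?thesis by (rule unambiguous)
qed

lemma part_finite: "i \<le> r \<Longrightarrow> finite (part i)"
  using fin_type representative unfolding finite_type_def tesselates_def node_part_def by auto

lemma vars_subset: "i \<le> r \<Longrightarrow> vars i \<subseteq> tree_vars X E \<T> r R y\<^sub>0"
  unfolding tree_vars_def by auto

text \<open>The graph has infinitely many edges, but right-hand sides are words of length at most 4 over
  finitely many symbols, so the set of productions is finite.\<close>

lemma context_free:
  assumes "i \<le> r" "v \<in> vars i"
  shows "context_free_grammar (\<G> v)"
proof -
  let ?V = "tree_vars X E \<T> r R y\<^sub>0"
  let ?F = "NT ` ?V \<union> TM ` A"
  have V: "finite ?V"
    using part_finite finite_subset [OF exits_subset part_finite]
    unfolding tree_vars_def node_vars_def by auto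
  have A: "finite A" using graph unfolding labelled_graph_def by blast
  have rhs: "v \<in> ?V \<and> set u \<subseteq> ?F \<and> length u \<le> 4" if vu: "(v, u) \<in> prods" for v u
  proof -
    obtain x y where v: "v = (x, y)" by (cases v)
    obtain i where i: "i \<le> r" "y \<in> exits i" using production_exit vu v by blast
    have var: "(x', y) \<in> ?V" if "x' \<in> part i" for x'
      using that i vars_subset unfolding node_vars_def by blast
    from vu have "((x, y), u) \<in> prods" using v by simp
    then show ?thesis using i
    proof (cases rule: production_cases)
      case empty
      then show ?thesis using var v i exits_subset by auto
    next
      case (edge a x')
      then show ?thesis using var v edgeD by auto
    next
      case (excursion a C xb yb b x'')
      have "C \<in> \<T>" using succsD [OF i(1)] excursion by auto
      then have "(\<phi> C xb, \<phi> C yb) \<in> ?V"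
        using excursion_var [OF _ excursion(4,5)] vars_subset by blast
      then show ?thesis using excursion var v edgeD [OF excursion(6)] edgeD [OF excursion(7)] by auto
    qed
  qed
  have "prods \<subseteq> ?V \<times> {u. set u \<subseteq> ?F \<and> length u \<le> 4}"
    using rhs by (intro subrelI) blast
  moreover have "finite {u. set u \<subseteq> ?F \<and> length u \<le> 4}"
    by (rule finite_lists_length_le) (use V A in auto)
  ultimately have "finite prods" using V by (blast intro: finite_subset [OF _ finite_SigmaI])
  moreover have "prods \<subseteq> ?V \<times> lists ?F" using rhs unfolding lists_eq_set by (intro subrelI) blast
  ultimately show ?thesis
    unfolding context_free_grammar_def using V A vars_subset [OF assms(1)] assms(2) by auto
qed


section \<open>The dependency digraph\<close>

lemma dep_path_refl: "dep_path P v v"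
  unfolding dep_path_def by blast

lemma dep_path_trans: "dep_path P u v \<Longrightarrow> dep_path P v w \<Longrightarrow> dep_path P u w"
  unfolding dep_path_def by (rule rtrancl_trans)

lemma dep_path_production: "(v, u) \<in> P \<Longrightarrow> NT v' \<in> set u \<Longrightarrow> dep_path P v v'"
  unfolding dep_path_def dependency_def by blast

lemma dep_path_within_node:
  assumes i: "i \<le> r" and x: "x \<in> part i" and x': "x' \<in> part i" and y: "y \<in> exits i"
  shows "dep_path prods (x, y) (x', y)"
proof -
  have "connected_on X E (part i)"
    using root_part_connected cut_part_connected representative i unfolding node_part_def by auto
  then have "strongly_connected (lgraph X E \<restriction> part i)" unfolding connected_on_def by blast
  then have "(x, x') \<in> {(u, v). u \<in> part i \<and> v \<in> part i \<and> (\<exists>a. (u, a, v) \<in> E)}\<^sup>*"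
    using rtrancl_if_strongly_connected [of "lgraph X E \<restriction> part i"] x x'
    unfolding arcs_ends_induced by simp
  then show ?thesis
  proof (induction rule: rtrancl_induct)
    case base
    show ?case by (rule dep_path_refl)
  next
    case (step u v)
    then obtain a where "u \<in> part i" "v \<in> part i" "(u, a, v) \<in> E" by blast
    then have "((u, y), [TM a, NT (v, y)]) \<in> prods" using tree_prods.edge i y by metis
    then have "dep_path prods (u, y) (v, y)" by (rule dep_path_production) simp
    with step.IH show ?case by (rule dep_path_trans)
  qed
qed

lemma dep_path_to_succ:
  assumes i: "i \<le> r" and C: "succs i C" and x: "x \<in> part i" and y: "y \<in> exits i"
    and x': "x' \<in> part (tp C)" and y': "y' \<in> exits (tp C)"
  shows "dep_path prods (x, y) (x', y')"
proof -
  have CT: "C \<in> \<T>" using succsD [OF i C] by auto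
  note tp = type_range [OF CT]
  then have "y' \<in> bdry X E (R (tp C))" using y' unfolding node_exit_def by auto
  then obtain yb where yb: "yb \<in> bdry X E C" "y' = \<phi> C yb" using type_bdry [OF CT] by blast
  then obtain b z where z: "(yb, b, z) \<in> E" "z \<notin> C" unfolding bdry_iff by blast
  have zi: "z \<in> part i"
    using leaving_succ_enters_part [OF i C _ z] yb(1) bdry_subset by blast
  obtain a where a: "(z, a, yb) \<in> E" using reverse_edge z by blast
  \<comment> \<open>the excursion that enters \<open>C\<close> along one edge and leaves along the reversed edge\<close>
  have "((z, y), [TM a, NT (\<phi> C yb, \<phi> C yb), TM b, NT (z, y)]) \<in> prods"
    using tree_prods.excursion [where \<T> = \<T>] i zi y C yb(1) a z(1) by metis
  then have "dep_path prods (z, y) (\<phi> C yb, \<phi> C yb)" by (rule dep_path_production) simp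
  moreover have "dep_path prods (x, y) (z, y)" by (rule dep_path_within_node [OF i x zi y])
  moreover have "dep_path prods (\<phi> C yb, \<phi> C yb) (x', y')"
    using dep_path_within_node [of "tp C" y' x' y'] exits_subset tp x' y' yb(2) by auto
  ultimately show ?thesis by (metis dep_path_trans)
qed

text \<open>The boundaries of the cuts in between are disjoint, and each of them meets a fixed finite path
  that leads from the smaller cut out of the larger one.\<close>

lemma finite_cuts_between:
  assumes C: "C \<in> \<T>" and D: "D \<in> \<T>"
  shows "finite {B \<in> \<T>. D \<subseteq> B \<and> B \<subseteq> C}"
proof -
  obtain d where d: "d \<in> D" using cut_bdry_nonempty [OF D] bdry_subset by blast
  obtain c where c: "c \<in> X" "c \<notin> C" using cut_bdry_nonempty [OF C] unfolding bdry_def by blast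
  have path: "(d, c) \<in> {(u, v). \<exists>a. (u, a, v) \<in> E}\<^sup>*"
    using rtrancl_if_strongly_connected [OF strong, of d c] d c cut_subset [OF D]
    unfolding arcs_ends_lgraph by (auto simp: lgraph_def)
  have edges: "E \<subseteq> X \<times> A \<times> X" using graph unfolding labelled_graph_def by blast
  obtain F where F: "finite F" "\<forall>B. d \<in> B \<and> c \<notin> B \<longrightarrow> bdry X E B \<inter> F \<noteq> {}"
    using finite_set_meeting_boundaries [OF path edges] by (elim exE conjE)
  let ?S = "{B \<in> \<T>. D \<subseteq> B \<and> B \<subseteq> C}"
  define f where "f = (\<lambda>B. SOME v. v \<in> bdry X E B \<inter> F)"
  have f: "f B \<in> bdry X E B \<inter> F" if "B \<in> ?S" for B
  proof -
    have "\<exists>v. v \<in> bdry X E B \<inter> F" using F(2) that d c by blast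
    then show ?thesis unfolding f_def by (rule someI_ex)
  qed
  have "inj_on f ?S"
  proof (rule inj_onI)
    fix B B' assume B: "B \<in> ?S" "B' \<in> ?S" "f B = f B'"
    have "f B \<in> bdry X E B" "f B \<in> bdry X E B'" using f [OF B(1)] f [OF B(2)] B(3) by auto
    then show "B = B'" using bdrys_disjoint [of B B'] B(1,2) by blast
  qed
  moreover have "f ` ?S \<subseteq> F" using f by blast
  ultimately show ?thesis using F(1) by (rule inj_on_finite)
qed

lemma cut_succ_towards:
  assumes C: "C \<in> \<T>" and D: "D \<in> \<T>" "D \<subset> C"
  obtains B where "cut_succ \<T> C B" "D \<subseteq> B"
proof -
  let ?S = "{B \<in> \<T>. D \<subseteq> B \<and> B \<subset> C}"
  have fin: "finite ?S" by (rule finite_subset [OF _ finite_cuts_between [OF C D(1)]]) auto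
  have ne: "?S \<noteq> {}" using D by blast
  obtain B where B: "B \<in> ?S" "\<forall>B'\<in>?S. B \<subseteq> B' \<longrightarrow> B = B'"
    using finite_has_maximal [OF fin ne] by (elim bexE)
  have "\<not> (B \<subset> B' \<and> B' \<subset> C)" if "B' \<in> \<T>" for B'
  proof
    assume B': "B \<subset> B' \<and> B' \<subset> C"
    then have "B' \<in> ?S" using that B(1) by auto
    then show False using B(2) B' by blast
  qed
  then have "cut_succ \<T> C B" using C B(1) unfolding cut_succ_def by auto
  moreover have "D \<subseteq> B" using B(1) by blast
  ultimately show thesis by (rule that)
qed

text \<open>Coherence makes \<open>\<phi> C ` D\<close> a cut of the tree set. If it were not a successor of the
  representative, it would lie properly in one, say \<open>B\<close>. But \<open>D\<close> has an edge to the part of \<open>C\<close>, hence \<open>\<phi> C ` D\<close> has one to the part of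
  the representative, which lies outside of \<open>B\<close>. Then the boundaries of \<open>B\<close> and \<open>\<phi> C ` D\<close> meet.\<close>

lemma image_cut_succ:
  assumes coherent: "types_coherent \<T> tp \<phi>" and CD: "cut_succ \<T> C D"
  shows "cut_succ \<T> (R (tp C)) (\<phi> C ` D)" and "tp (\<phi> C ` D) = tp D"
proof -
  let ?D = "\<phi> C ` D" and ?R = "R (tp C)"
  have D: "C \<in> \<T>" "D \<in> \<T>" "D \<subset> C" using CD unfolding cut_succ_def by auto
  have img: "?D \<in> \<T>" and "tp ?D = tp D" using coherent CD unfolding types_coherent_def by auto
  show "tp ?D = tp D" by fact
  have RT: "?R \<in> \<T>" using representative type_range D(1) by blast
  have inj: "inj_on (\<phi> C) C" and surj: "\<phi> C ` C = ?R"
    and hom: "\<And>x y a. x \<in> C \<Longrightarrow> y \<in> C \<Longrightarrow> (x, a, y) \<in> E \<Longrightarrow> (\<phi> C x, a, \<phi> C y) \<in> E"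
    using type_iso [OF D(1)] unfolding labelled_iso_def bij_betw_def by auto
  obtain y where y: "y \<in> bdry X E D" using cut_bdry_nonempty D by blast
  then obtain a z where z: "(y, a, z) \<in> E" "z \<notin> D" "y \<in> D" unfolding bdry_iff by blast
  have zC: "z \<in> C"
  proof (rule ccontr)
    assume "z \<notin> C"
    then have "y \<in> bdry X E C" using bdryI z D(3) by blast
    then show False using bdry_disjoint_smaller_cut D z by blast
  qed
  have "z \<in> cut_part \<T> C"
  proof (rule ccontr)
    assume "z \<notin> cut_part \<T> C"
    then obtain D' where D': "cut_succ \<T> C D'" "z \<in> D'" using zC unfolding cut_part_def by blast
    then have "D' \<inter> D = {}"
      using cuts_nested_or_disjoint [of D D'] CD z(2) unfolding cut_succ_def by blast
    then show False
      using no_edge_between_disjoint_cuts [of D D' y z a] D' D z unfolding cut_succ_def by blast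
  qed
  then have \<phi>z: "\<phi> C z \<in> cut_part \<T> ?R" using type_part D(1) by blast
  have edge: "(\<phi> C y, a, \<phi> C z) \<in> E" using hom z D(3) zC by blast
  have z_out: "\<phi> C z \<notin> ?D" using inj zC z(2) D(3) by (auto dest: inj_onD)
  have "?D \<subset> ?R" using z_out surj D(3) zC by blast
  then obtain B where B: "cut_succ \<T> ?R B" "?D \<subseteq> B" using cut_succ_towards [OF RT img] by blast
  have "\<phi> C z \<notin> B" using \<phi>z B(1) unfolding cut_part_def by blast
  then have "\<phi> C y \<in> bdry X E B" "\<phi> C y \<in> bdry X E ?D"
    using bdryI [OF _ edge] z(3) B(2) z_out by blast+
  then have "B = ?D" using bdrys_disjoint [of B ?D] B(1) img unfolding cut_succ_def by blast
  then show "cut_succ \<T> ?R ?D" using B(1) by simp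
qed

text \<open>A chain of successors \<open>R i \<rightarrow> C\<^sub>1 \<rightarrow> \<dots> \<rightarrow> D\<close> gives dependencies through the types of its
  members. Only the first step starts at a representative; each later successor is moved to the
  representative of the type of its predecessor by \<open>image_cut_succ\<close>.\<close>

lemma dep_path_to_type_of_smaller_cut:
  assumes coherent: "types_coherent \<T> tp \<phi>"
    and "i \<in> {1..r}" "D \<in> \<T>" "D \<subset> R i" and v: "v \<in> vars i" and v': "v' \<in> vars (tp D)"
  shows "dep_path prods v v'"
proof -
  have node_succ: "succs i C \<longleftrightarrow> cut_succ \<T> (R i) C" if "i \<in> {1..r}" for i C
    using that unfolding node_succ_def by auto
  have vars_nonempty: "vars i \<noteq> {}" if "i \<in> {1..r}" for i
    using that cut_bdry_nonempty [OF representative [OF that]] exits_subset [of i]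
    unfolding node_vars_def node_exit_def by auto
  have step: "dep_path prods v v'"
    if "i \<in> {1..r}" "succs i C" "v \<in> vars i" "v' \<in> vars (tp C)" for i C v v'
    using that dep_path_to_succ [of i C] unfolding node_vars_def by auto
  have chain: "dep_path prods v v'"
    if "B \<in> \<T>" "D \<subseteq> B" "B \<noteq> D" "v \<in> vars (tp B)" "v' \<in> vars (tp D)" for B v v'
    using that
  proof (induction "card {B' \<in> \<T>. D \<subseteq> B' \<and> B' \<subseteq> B}" arbitrary: B v rule: less_induct)
    case less
    obtain B' where B': "cut_succ \<T> B B'" "D \<subseteq> B'"
      using cut_succ_towards [OF less.prems(1) \<open>D \<in> \<T>\<close>] less.prems(2,3) by blast
    have T: "B' \<in> \<T>" "B' \<subset> B" using B'(1) unfolding cut_succ_def by auto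
    have range: "tp B \<in> {1..r}" "tp B' \<in> {1..r}" using type_range less.prems T by auto
    have first: "dep_path prods v u" if "u \<in> vars (tp B')" for u
      using step [OF range(1), of "\<phi> B ` B'" v u] image_cut_succ [OF coherent B'(1)]
        node_succ [OF range(1)] less.prems(4) that by auto
    show ?case
    proof (cases "B' = D")
      case True
      then show ?thesis using first less.prems by blast
    next
      case False
      obtain u where u: "u \<in> vars (tp B')" using vars_nonempty [OF range(2)] by blast
      have "{B'' \<in> \<T>. D \<subseteq> B'' \<and> B'' \<subseteq> B'} \<subset> {B' \<in> \<T>. D \<subseteq> B' \<and> B' \<subseteq> B}"
        using T less.prems by blast
      then have "card {B'' \<in> \<T>. D \<subseteq> B'' \<and> B'' \<subseteq> B'} < card {B' \<in> \<T>. D \<subseteq> B' \<and> B' \<subseteq> B}"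
        by (rule psubset_card_mono [OF finite_cuts_between [OF \<open>B \<in> \<T>\<close> \<open>D \<in> \<T>\<close>]])
      then have "dep_path prods u v'" by (rule less.hyps [OF _ T(1) B'(2) False u less.prems(5)])
      with first [OF u] show ?thesis by (rule dep_path_trans)
    qed
  qed
  obtain B where B: "cut_succ \<T> (R i) B" "D \<subseteq> B"
    using cut_succ_towards [OF representative assms(3,4)] assms(2) by blast
  have T: "B \<in> \<T>" using B(1) unfolding cut_succ_def by auto
  obtain u where u: "u \<in> vars (tp B)" using vars_nonempty type_range [OF T] by blast
  have first: "dep_path prods v u" if "u \<in> vars (tp B)" for u
    using step [OF assms(2)] node_succ [OF assms(2)] B(1) v that by blast
  show ?thesis
  proof (cases "B = D")
    case True
    then show ?thesis using first v' by blast
  next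
    case False
    show ?thesis by (rule dep_path_trans [OF first [OF u] chain [OF T B(2) False u v']])
  qed
qed

definition essential_vars :: "('v \<times> 'v) set" where
  "essential_vars = (\<Union>i\<in>{1..r}. vars i)"

lemma tree_vars_eq: "tree_vars X E \<T> r R y\<^sub>0 = vars 0 \<union> essential_vars"
proof -
  have "{0..r} = insert 0 {1..r}" by auto
  then show ?thesis unfolding tree_vars_def essential_vars_def by simp
qed

lemma root_vars_not_essential: "vars 0 \<inter> essential_vars = {}"
proof -
  have "y \<noteq> y\<^sub>0" if "i \<in> {1..r}" "(x, y) \<in> vars i" for i x y
    using that y0 bdry_subset [of "R i"] representative [OF that(1)]
    unfolding node_vars_def node_exit_def root_part_iff by auto
  then show ?thesis unfolding essential_vars_def by (fastforce simp: node_vars_def node_exit_def)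
qed

text \<open>A production whose variable ends in an exit \<open>y\<close> of a representative only mentions variables
  with the same \<open>y\<close> and variables of successors.\<close>

lemma dep_path_from_essential:
  assumes "dep_path prods v v'" and "v \<in> essential_vars"
  shows "v' \<in> essential_vars"
  using assms(1) unfolding dep_path_def
proof (induction rule: rtrancl_induct)
  case base
  show ?case by fact
next
  case (step v v')
  obtain u where u: "(v, u) \<in> prods" "NT v' \<in> set u"
    using step.hyps(2) unfolding dependency_def by blast
  obtain i x y where i: "i \<in> {1..r}" "v = (x, y)" "y \<in> exits i"
    using step.IH unfolding essential_vars_def node_vars_def by blast
  have ess: "w \<in> essential_vars" if "j \<le> r" "j \<noteq> 0" "w \<in> vars j" for j w
    using that unfolding essential_vars_def by force
  have "((x, y), u) \<in> prods" "i \<le> r" using u i by auto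
  then show ?case using i(3)
  proof (cases rule: production_cases)
    case empty
    then show ?thesis using u by simp
  next
    case (edge a x')
    then show ?thesis using u i ess [of i] unfolding node_vars_def by auto
  next
    case (excursion a C xb yb b x'')
    have "C \<in> \<T>" using succsD(1) [of i C] excursion i by auto
    then have "(\<phi> C xb, \<phi> C yb) \<in> essential_vars"
      using excursion_var [OF _ excursion(4,5)] ess by blast
    moreover have "(x'', y) \<in> essential_vars"
      using excursion i ess [of i] unfolding node_vars_def by auto
    ultimately show ?thesis using u excursion by auto
  qed
qed

text \<open>The two classes differ because no production leads from the types back to the root. Inside
  \<open>essential_vars\<close>, irreducibility provides a cut of the required type, and the chain of
  successors that leads to it is followed type by type.\<close>

lemma strong_components_grammar:
  assumes irr: "irreducible_type X E \<T> r R tp \<phi>" and coherent: "types_coherent \<T> tp \<phi>"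
  shows "strong_components (tree_vars X E \<T> r R y\<^sub>0) prods = {vars 0, essential_vars}"
    and "comp_le prods (vars 0) essential_vars"
proof -
  let ?V = "tree_vars X E \<T> r R y\<^sub>0"
  let ?Q = "{(v, v'). v \<in> ?V \<and> v' \<in> ?V \<and> dep_path prods v v' \<and> dep_path prods v' v}"
  have root_class: "dep_path prods v v'" if "v \<in> vars 0" "v' \<in> vars 0" for v v'
    using that dep_path_within_node [of 0] unfolding node_vars_def node_exit_def by auto
  have ess: "dep_path prods v v'" if v: "v \<in> essential_vars" "v' \<in> essential_vars" for v v'
  proof -
    obtain i j where ij: "i \<in> {1..r}" "v \<in> vars i" "j \<in> {1..r}" "v' \<in> vars j"
      using v unfolding essential_vars_def by blast
    then obtain D where "D \<in> \<T>" "D \<subset> R i" "tp D = j"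
      using irr unfolding irreducible_type_def by blast
    then show ?thesis using dep_path_to_type_of_smaller_cut [OF coherent] ij by blast
  qed
  have class0: "?Q `` {v} = vars 0" if "v \<in> vars 0" for v
    using that root_class dep_path_from_essential root_vars_not_essential unfolding tree_vars_eq by blast
  have class1: "?Q `` {v} = essential_vars" if "v \<in> essential_vars" for v
    using that ess dep_path_from_essential root_vars_not_essential unfolding tree_vars_eq by blast
  have v0: "(y\<^sub>0, y\<^sub>0) \<in> vars 0"
    using y0 unfolding node_vars_def node_part_def node_exit_def by simp
  obtain C where C: "maximal_cut \<T> C"
    using root tree_set_nonempty unfolding rooted_def by blast
  then have CT: "C \<in> \<T>" unfolding maximal_cut_def by blast
  obtain y where y: "y \<in> bdry X E C" using cut_bdry_nonempty [OF CT] by blast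
  define v1 where "v1 = (\<phi> C y, \<phi> C y)"
  have v1: "v1 \<in> vars (tp C)" using excursion_var(3) [OF CT y y] unfolding v1_def .
  then have v1_ess: "v1 \<in> essential_vars"
    using type_range [OF CT] unfolding essential_vars_def by blast
  have "?V // ?Q = (\<lambda>v. ?Q `` {v}) ` vars 0 \<union> (\<lambda>v. ?Q `` {v}) ` essential_vars"
    unfolding quotient_def tree_vars_eq by blast
  also have "(\<lambda>v. ?Q `` {v}) ` vars 0 = {vars 0}" using class0 v0 by blast
  also have "(\<lambda>v. ?Q `` {v}) ` essential_vars = {essential_vars}" using class1 v1_ess by blast
  finally show "strong_components ?V prods = {vars 0, essential_vars}"
    unfolding strong_components_def by blast
  have "succs 0 C" using C unfolding node_succ_def by simp
  then have "dep_path prods (y\<^sub>0, y\<^sub>0) v1"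
    using dep_path_to_succ [of 0 C y\<^sub>0 y\<^sub>0] v0 v1 unfolding node_vars_def by blast
  then show "comp_le prods (vars 0) essential_vars" using v0 v1_ess unfolding comp_le_def by blast
qed

end

theorem mainTheorem7:
  fixes X :: "'v set" and A :: "'a set" and E :: "('v \<times> 'a \<times> 'v) set"
    and \<T> :: "'v set set" and r :: nat and R :: "nat \<Rightarrow> 'v set"
    and tp :: "'v set \<Rightarrow> nat" and \<phi> :: "'v set \<Rightarrow> 'v \<Rightarrow> 'v" and y\<^sub>0 :: 'v
  defines "P \<equiv> tree_prods X E \<T> r R \<phi> y\<^sub>0"
    and "V \<equiv> tree_vars X E \<T> r R y\<^sub>0"
    and "V\<^sub>0 \<equiv> node_vars X E \<T> R y\<^sub>0 0"
    and "V\<^sub>e\<^sub>s\<^sub>s \<equiv> (\<Union>i\<in>{1..r}. node_vars X E \<T> R y\<^sub>0 i)"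
  assumes "labelled_graph X A E" and "infinite X" and "strongly_connected (lgraph X E)"
    and "symmetric_labelled A E" and "fully_deterministic X A E"
    and "oriented_tree_set X E \<T>" and "rooted \<T>" and "finite_type X E \<T> r R tp \<phi>"
    and "separated X E \<T>" and "disjoint_cuts_apart X E \<T>"
    and "connected_on X E (root_part X \<T>)"
    and "\<forall>C\<in>\<T>. connected_on X E (cut_part \<T> C)"
    and "y\<^sub>0 \<in> root_part X \<T>"
  shows
    "(\<forall>i\<in>{0..r}. \<forall>x y. (x, y) \<in> node_vars X E \<T> R y\<^sub>0 i \<longrightarrow>
        context_free_grammar (tree_grammar X A E \<T> r R \<phi> y\<^sub>0 (x, y)) \<and>
        unambiguous (tree_grammar X A E \<T> r R \<phi> y\<^sub>0 (x, y)) \<and>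
        gen_lang (tree_grammar X A E \<T> r R \<phi> y\<^sub>0 (x, y)) = path_lang X E (node X R i) x y)
     \<and>
     (\<forall>i\<in>{0..r}. \<forall>x \<in> node_part X \<T> R i. \<forall>x' \<in> node_part X \<T> R i. \<forall>y \<in> node_exit X E R y\<^sub>0 i.
        dep_path P (x, y) (x', y))
     \<and>
     (\<forall>i\<in>{0..r}. \<forall>C. node_succ \<T> R i C \<longrightarrow>
        (\<forall>x \<in> node_part X \<T> R i. \<forall>y \<in> node_exit X E R y\<^sub>0 i.
         \<forall>x' \<in> node_part X \<T> R (tp C). \<forall>y' \<in> node_exit X E R y\<^sub>0 (tp C).
           dep_path P (x, y) (x', y')))
     \<and>
     (irreducible_type X E \<T> r R tp \<phi> \<and> types_coherent \<T> tp \<phi> \<longrightarrow>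
        strong_components V P = {V\<^sub>0, V\<^sub>e\<^sub>s\<^sub>s} \<and> comp_le P V\<^sub>0 V\<^sub>e\<^sub>s\<^sub>s)"
proof -
  interpret tree_set_grammar X A E \<T> r R tp \<phi> y\<^sub>0
    using assms(5,7-) by unfold_locales
  have ess: "V\<^sub>e\<^sub>s\<^sub>s = essential_vars" unfolding V\<^sub>e\<^sub>s\<^sub>s_def essential_vars_def ..
  have a: "context_free_grammar (tree_grammar X A E \<T> r R \<phi> y\<^sub>0 (x, y)) \<and>
      unambiguous (tree_grammar X A E \<T> r R \<phi> y\<^sub>0 (x, y)) \<and>
      gen_lang (tree_grammar X A E \<T> r R \<phi> y\<^sub>0 (x, y)) = path_lang X E (node X R i) x y"
    if "i \<in> {0..r}" "(x, y) \<in> node_vars X E \<T> R y\<^sub>0 i" for i x y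
    using that context_free [of i] unambiguous_grammar gen_lang_grammar [of i] by simp
  have b1: "dep_path P (x, y) (x', y)"
    if "i \<in> {0..r}" "x \<in> part i" "x' \<in> part i" "y \<in> exits i" for i x x' y
    unfolding P_def using that dep_path_within_node by simp
  have b2: "dep_path P (x, y) (x', y')"
    if "i \<in> {0..r}" "succs i C" "x \<in> part i" "y \<in> exits i" "x' \<in> part (tp C)" "y' \<in> exits (tp C)"
    for i C x y x' y'
    unfolding P_def using that dep_path_to_succ [of i C] by simp
  have c: "strong_components V P = {V\<^sub>0, V\<^sub>e\<^sub>s\<^sub>s} \<and> comp_le P V\<^sub>0 V\<^sub>e\<^sub>s\<^sub>s"
    if "irreducible_type X E \<T> r R tp \<phi>" "types_coherent \<T> tp \<phi>"
    using strong_components_grammar [OF that] unfolding ess unfolding P_def V_def V\<^sub>0_def by blast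
  show ?thesis
    by (intro conjI ballI allI impI; (elim conjE)?;
        (rule a [THEN conjunct1] a [THEN conjunct2, THEN conjunct1]
           a [THEN conjunct2, THEN conjunct2] b1 b2 c [THEN conjunct1] c [THEN conjunct2];
         assumption))
qed

end
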